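(* Let $n\ge2$, $1\le k \le n-1$, $v\in V_{n+1, n-k}$. For any spherical harmonic $Y_j$ of degree $j$ on $S^n$ and any $\tau \in [0,1]$, $$(M_\tau Y_j) (v)= \begin{cases} 0 & \text{if } j \text{ is odd},\\ \hat m_\tau (j)\, \hat Y_j (v) & \text{if } j \text{ is even}.\end{cases}$$ Here, for $j$ even, $$\hat m_\tau (j)= \frac{\varkappa_j}{\sqrt {d_n(j)}}\, R^{(\rho,\sigma)}_{j/2} (2\tau^2 -1),$$ and $\hat Y_j$ is the Stiefel harmonic induced by $Y_j$, $$\hat Y_j (v)= \varkappa_j \sqrt {d_n(j)}\int_{S^n} Y_j (x)\, R^{(\rho, \sigma)}_{j/2} (2|x^T v|^2-1)\, d_*x,$$ with $\rho=(k-1)/2$, $\sigma=(n-k)/2-1$.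
   Context: $S^n\subset\mathbb{R}^{n+1}$ is the unit sphere, $d_*x$ its normalized (probability) surface measure, $\sigma_m=2\pi^{(m+1)/2}/\Gamma((m+1)/2)$ the area of $S^m$ (so $\sigma_0=2$). $V_{n+1,n-k}$ is the Stiefel manifold of real $(n+1)\times(n-k)$ matrices $v$ with $v^Tv=I_{n-k}$. For $x\in S^n$ (a column vector), $|x^Tv|$ is the Euclidean norm of the row vector $x^Tv$. Bispherical mean: let $S^k$ and $S^{n-k-1}$ be the unit spheres in $\mathrm{span}(e_1,\dots,e_{k+1})$ and $\mathrm{span}(e_{k+2},\dots,e_{n+1})$ with normalized surface measures $d_*\eta$, $d_*\zeta$ ($S^0=\{\pm1\}$ with mass $1/2$ at each point), $v_0=\begin{bmatrix}0\\ I_{n-k}\end{bmatrix}$, and $r_v\in O(n+1)$ any map with $r_vv_0=v$. Then $$(M_\tau f)(v)=\int_{S^{n-k-1}}d_*\zeta\int_{S^k}f\big(r_v(\eta\sqrt{1-\tau^2}+\zeta\tau)\big)\,d_*\eta,\qquad \tau\in[0,1].$$ Constants and polynomials: $d_n(j)=(n+2j-1)\dfrac{\Gamma(n+j-1)}{\Gamma(j+1)\Gamma(n)}$ is the dimension of the space of spherical harmonics of degree $j$ on $S^n$; $R^{(\rho,\sigma)}_m(t)=P^{(\rho,\sigma)}_m(t)/P^{(\rho,\sigma)}_m(1)$ is the normalized Jacobi polynomial; for $j$ even, $$\varkappa_j=\left[\frac{\sigma_n\,(2j+n-1)\,\Gamma\left(\frac{j+k+1}{2}\right)\Gamma\left(\frac{j+n-1}{2}\right)}{\sigma_{n-k-1}\sigma_k\,\Gamma^2\left(\frac{k+1}{2}\right)\Gamma\left(\frac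 j2+1\right)\Gamma\left(\frac{j+n-k}{2}\right)}\right]^{1/2}.$$ *)

theory Defs
  imports "HOL-Analysis.Analysis"
begin

section \<open>The normalized surface measure on the unit sphere\<close>

text \<open>
  The cone construction of normalized surface measure: a Borel set \<open>A\<close> of unit vectors gets the
  proportion of the unit ball occupied by the cone \<open>{r *\<^sub>R x | r x. 0 < r \<le> 1 \<and> x \<in> A}\<close>. Note that
  \<open>sgn x = x /\<^sub>R norm x\<close>. In dimension one this is mass \<open>1/2\<close> at each of the two points. The
  measure lives on the sphere itself, so integrals do not see values of the integrand elsewhere.
\<close>

definition sphere_measure :: "'a::euclidean_space measure" where
  "sphere_measure =
     restrict_space (distr (uniform_measure lborel (cball 0 1)) borel sgn) (sphere 0 1)"

definition sphere_area :: "nat \<Rightarrow> real" where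
  "sphere_area m = 2 * pi powr ((real m + 1) / 2) / Gamma ((real m + 1) / 2)"


section \<open>Spherical harmonics\<close>

definition partial_derivative ::
    "'a \<Rightarrow> ('a::euclidean_space \<Rightarrow> 'b::real_normed_vector) \<Rightarrow> 'a \<Rightarrow> 'b" where
  "partial_derivative b f x = vector_derivative (\<lambda>t. f (x + t *\<^sub>R b)) (at 0)"

definition laplacian :: "('a::euclidean_space \<Rightarrow> 'b::real_normed_vector) \<Rightarrow> 'a \<Rightarrow> 'b" where
  "laplacian f x = (\<Sum>b\<in>Basis. partial_derivative b (partial_derivative b f) x)"

text \<open>
  A spherical harmonic of degree \<open>j\<close> is the restriction to the unit sphere of a harmonic homogeneous
  polynomial of degree \<open>j\<close> (with complex coefficients, which includes the real case).
  Nothing is said about \<open>Y\<close> off the sphere.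
\<close>

definition spherical_harmonic :: "nat \<Rightarrow> ('a::euclidean_space \<Rightarrow> complex) \<Rightarrow> bool" where
  "spherical_harmonic j Y \<longleftrightarrow>
     (\<exists>P. polynomial_function P \<and>
          (\<forall>t x. P (t *\<^sub>R x) = t ^ j *\<^sub>R P x) \<and>
          (\<forall>x. laplacian P x = 0) \<and>
          (\<forall>x\<in>sphere 0 1. Y x = P x))"

definition harmonic_dim :: "nat \<Rightarrow> nat \<Rightarrow> real" where
  "harmonic_dim n j =
     (real n + 2 * real j - 1) * Gamma (real n + real j - 1) / (Gamma (real j + 1) * Gamma (real n))"


section \<open>Jacobi polynomials\<close>

text \<open>Szegoe's expansion in powers of \<open>(t - 1) / 2\<close> and \<open>(t + 1) / 2\<close>, standard normalization
  \<open>jacobi_P a b m 1 = (m + a) gchoose m\<close>.\<close>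

definition jacobi_P :: "real \<Rightarrow> real \<Rightarrow> nat \<Rightarrow> real \<Rightarrow> real" where
  "jacobi_P a b m t =
     (\<Sum>s\<le>m. ((real m + a) gchoose (m - s)) * ((real m + b) gchoose s) *
             ((t - 1) / 2) ^ s * ((t + 1) / 2) ^ (m - s))"

definition jacobi_R :: "real \<Rightarrow> real \<Rightarrow> nat \<Rightarrow> real \<Rightarrow> real" where
  "jacobi_R a b m t = jacobi_P a b m t / jacobi_P a b m 1"


section \<open>Stiefel manifold and bispherical means\<close>

text \<open>
  \<open>\<real>\<^sup>n\<^sup>+\<^sup>1\<close> is rendered as \<open>real ^ ('p + 'q)\<close> with \<open>CARD('p) = k + 1\<close> and \<open>CARD('q) = n - k\<close>: the index
  \<open>Inl i\<close> runs over the first \<open>k + 1\<close> coordinates and \<open>Inr i\<close> over the last \<open>n - k\<close>.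
  A matrix with \<open>n + 1\<close> rows and \<open>n - k\<close> columns is an element of \<open>real ^ 'q ^ ('p + 'q)\<close>.
\<close>

definition stiefel :: "(real ^ 'm ^ 'n) set" where
  "stiefel = {v. transpose v ** v = mat 1}"

definition vec_join :: "real ^ 'p \<Rightarrow> real ^ 'q \<Rightarrow> real ^ ('p::finite + 'q::finite)" where
  "vec_join x y = (\<chi> i. case i of Inl a \<Rightarrow> x $ a | Inr b \<Rightarrow> y $ b)"

definition stiefel_base :: "real ^ 'q ^ ('p::finite + 'q::finite)" where
  "stiefel_base = (\<chi> i j. case i of Inl a \<Rightarrow> 0 | Inr b \<Rightarrow> mat 1 $ b $ j)"

definition bispherical_integral ::
    "real ^ ('p::finite + 'q::finite) ^ ('p::finite + 'q::finite) \<Rightarrow> real \<Rightarrow> (real ^ ('p::finite + 'q::finite) \<Rightarrow> complex) \<Rightarrow> complex" where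
  "bispherical_integral r \<tau> f =
     (LINT \<zeta>|sphere_measure. LINT \<eta>|sphere_measure.
        f (r *v vec_join (sqrt (1 - \<tau>\<^sup>2) *\<^sub>R \<eta>) (\<tau> *\<^sub>R \<zeta>)))"

text \<open>
  Any orthogonal \<open>r\<close> with \<open>r ** stiefel_base = v\<close> may be used here: such an \<open>r\<close> exists
  (\<open>stiefel_rotation_exists\<close> below) and for measurable \<open>f\<close> the choice does not matter (\<open>bispherical_mean_eq\<close>).
\<close>

definition bispherical_mean ::
    "real \<Rightarrow> (real ^ ('p::finite + 'q::finite) \<Rightarrow> complex) \<Rightarrow> real ^ 'q ^ ('p::finite + 'q::finite) \<Rightarrow> complex" where
  "bispherical_mean \<tau> f v =
     bispherical_integral (SOME r. orthogonal_matrix r \<and> r ** stiefel_base = v) \<tau> f"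


section \<open>Stiefel harmonics and multipliers\<close>

definition varkappa :: "nat \<Rightarrow> nat \<Rightarrow> nat \<Rightarrow> real" where
  "varkappa n k j = sqrt
     (sphere_area n * (2 * real j + real n - 1) *
        Gamma ((real j + real k + 1) / 2) * Gamma ((real j + real n - 1) / 2) /
      (sphere_area (n - k - 1) * sphere_area k * (Gamma ((real k + 1) / 2))\<^sup>2 *
        Gamma (real j / 2 + 1) * Gamma ((real j + real n - real k) / 2)))"

definition jacobi_nk :: "nat \<Rightarrow> nat \<Rightarrow> nat \<Rightarrow> real \<Rightarrow> real" where
  "jacobi_nk n k m t = jacobi_R ((real k - 1) / 2) ((real n - real k) / 2 - 1) m t"

definition multiplier :: "nat \<Rightarrow> nat \<Rightarrow> real \<Rightarrow> nat \<Rightarrow> real" where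
  "multiplier n k \<tau> j =
     varkappa n k j / sqrt (harmonic_dim n j) * jacobi_nk n k (j div 2) (2 * \<tau>\<^sup>2 - 1)"

definition stiefel_harmonic ::
    "nat \<Rightarrow> nat \<Rightarrow> nat \<Rightarrow> (real ^ 'n \<Rightarrow> complex) \<Rightarrow> real ^ 'm ^ 'n \<Rightarrow> complex" where
  "stiefel_harmonic n k j Y v =
     of_real (varkappa n k j * sqrt (harmonic_dim n j)) *
     (LINT x|sphere_measure. Y x * of_real (jacobi_nk n k (j div 2) (2 * (norm (x v* v))\<^sup>2 - 1)))"


section \<open>The bispherical mean is well defined\<close>

lemma lborel_distr_orthogonal:
  fixes T :: "'a::euclidean_space \<Rightarrow> 'a"
  assumes T: "orthogonal_transformation T"
  shows "distr lborel borel T = lborel"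
proof -
  have linT: "linear T" and bijT: "bij T"
    using T by (auto simp: orthogonal_transformation_linear orthogonal_transformation_bij)
  have [measurable]: "T \<in> borel_measurable borel"
    using linT by (intro borel_measurable_continuous_onI linear_continuous_on linear_linear[THEN iffD1])
      (simp add: linear_conv_bounded_linear)
  define \<mu> where "\<mu> = distr lborel borel T"
  have sets\<mu> [measurable_cong, simp]: "sets \<mu> = sets borel" by (simp add: \<mu>_def)
  define B where "B = cball (0::'a) 1"
  have [measurable]: "B \<in> sets borel" by (simp add: B_def)
  have nn\<mu>: "(\<integral>\<^sup>+x. f x \<partial>\<mu>) = (\<integral>\<^sup>+x. f (T x) \<partial>lborel)"
    if [measurable]: "f \<in> borel_measurable borel" for f :: "'a \<Rightarrow> ennreal"
    unfolding \<mu>_def by (subst nn_integral_distr) auto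
  have transl: "(\<integral>\<^sup>+x. f (x + a) \<partial>lborel) = (\<integral>\<^sup>+x. f x \<partial>lborel)"
    if [measurable]: "f \<in> borel_measurable borel" for f :: "'a \<Rightarrow> ennreal" and a
  proof -
    have "(\<integral>\<^sup>+x. f x \<partial>lborel) = (\<integral>\<^sup>+x. f x \<partial>distr lborel borel ((+) a))"
      by (simp add: lborel_distr_plus)
    also have "\<dots> = (\<integral>\<^sup>+x. f (x + a) \<partial>lborel)"
      by (subst nn_integral_distr) (auto simp: add.commute)
    finally show ?thesis by simp
  qed
  have refl: "(\<integral>\<^sup>+x. f (- x) \<partial>lborel) = (\<integral>\<^sup>+x. f x \<partial>lborel)"
    if [measurable]: "f \<in> borel_measurable borel" for f :: "'a \<Rightarrow> ennreal"
  proof -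
    have "lborel = distr lborel borel (\<lambda>x::'a. - x)"
      using lborel_affine_euclidean[where c = "\<lambda>_. -1" and t = 0]
      by (simp add: density_1 scaleR_conv_of_real[symmetric] sum_negf euclidean_representation)
    then have "(\<integral>\<^sup>+x. f x \<partial>lborel) = (\<integral>\<^sup>+x. f x \<partial>distr lborel borel (\<lambda>x::'a. - x))" by simp
    also have "\<dots> = (\<integral>\<^sup>+x. f (- x) \<partial>lborel)"
      by (subst nn_integral_distr) auto
    finally show ?thesis by simp
  qed
  have emB: "emeasure \<mu> B = emeasure lborel B"
  proof -
    have "T -` B = B"
      using T by (auto simp: B_def orthogonal_transformation_norm)
    then show ?thesis unfolding \<mu>_def by (subst emeasure_distr) auto
  qed
  have eq: "emeasure \<mu> A = emeasure lborel A" if A[measurable]: "A \<in> sets borel" for A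
  proof -
    let ?f = "\<lambda>x. indicator A x :: ennreal" and ?g = "\<lambda>x. indicator B x :: ennreal"
    have "(\<integral>\<^sup>+x. ?f x \<partial>\<mu>) * (\<integral>\<^sup>+y. ?g y \<partial>lborel)
        = (\<integral>\<^sup>+x. ?f (T x) * (\<integral>\<^sup>+y. ?g (y + T x) \<partial>lborel) \<partial>lborel)"
      by (simp only: nn\<mu>[OF borel_measurable_indicator[OF A]]
          transl[OF borel_measurable_indicator[OF \<open>B \<in> sets borel\<close>]])
        (simp add: nn_integral_multc)
    also have "\<dots> = (\<integral>\<^sup>+x. (\<integral>\<^sup>+y. ?f (T x) * ?g (y + T x) \<partial>lborel) \<partial>lborel)"
      by (simp add: nn_integral_cmult)
    also have "\<dots> = (\<integral>\<^sup>+y. (\<integral>\<^sup>+x. ?f (T x) * ?g (y + T x) \<partial>lborel) \<partial>lborel)"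
      by (rule lborel_pair.Fubini') measurable
    also have "\<dots> = (\<integral>\<^sup>+y. (\<integral>\<^sup>+x. ?f (T x - y) * ?g (T x) \<partial>lborel) \<partial>lborel)"
    proof (rule nn_integral_cong)
      fix y
      obtain c where c: "T c = y" using bijT by (metis bij_pointE)
      have "(\<integral>\<^sup>+x. ?f (T x) * ?g (y + T x) \<partial>lborel)
          = (\<integral>\<^sup>+x. (\<lambda>x. ?f (T x - y) * ?g (T x)) (x + c) \<partial>lborel)"
        using c by (simp add: linear_add[OF linT] add.commute)
      also have "\<dots> = (\<integral>\<^sup>+x. ?f (T x - y) * ?g (T x) \<partial>lborel)"
        by (rule transl) measurable
      finally show "(\<integral>\<^sup>+x. ?f (T x) * ?g (y + T x) \<partial>lborel)
          = (\<integral>\<^sup>+x. ?f (T x - y) * ?g (T x) \<partial>lborel)" .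
    qed
    also have "\<dots> = (\<integral>\<^sup>+x. (\<integral>\<^sup>+y. ?f (T x - y) * ?g (T x) \<partial>lborel) \<partial>lborel)"
      by (rule lborel_pair.Fubini') measurable
    also have "\<dots> = (\<integral>\<^sup>+x. (\<integral>\<^sup>+y. ?f y \<partial>lborel) * ?g (T x) \<partial>lborel)"
    proof (rule nn_integral_cong)
      fix x
      have "(\<integral>\<^sup>+y. ?f (T x - y) \<partial>lborel) = (\<integral>\<^sup>+y. (\<lambda>y. ?f (T x + y)) (- y) \<partial>lborel)" by simp
      also have "\<dots> = (\<integral>\<^sup>+y. ?f (T x + y) \<partial>lborel)" by (rule refl) measurable
      also have "\<dots> = (\<integral>\<^sup>+y. ?f y \<partial>lborel)"
        using transl[of ?f "T x"] by (simp add: add.commute)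
      finally show "(\<integral>\<^sup>+y. ?f (T x - y) * ?g (T x) \<partial>lborel) = (\<integral>\<^sup>+y. ?f y \<partial>lborel) * ?g (T x)"
        by (simp add: nn_integral_multc)
    qed
    also have "\<dots> = (\<integral>\<^sup>+y. ?f y \<partial>lborel) * (\<integral>\<^sup>+x. ?g x \<partial>\<mu>)"
      by (simp only: nn\<mu>[OF borel_measurable_indicator[OF \<open>B \<in> sets borel\<close>]])
        (simp add: nn_integral_cmult)
    finally have "emeasure \<mu> A * emeasure lborel B = emeasure lborel A * emeasure \<mu> B"
      by simp
    moreover have "emeasure lborel B \<noteq> 0" "emeasure lborel B \<noteq> \<infinity>"
      using content_cball_pos[of 1 "0::'a"] emeasure_lborel_cball_finite[of "0::'a" 1]
      by (auto simp: B_def measure_def)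
    ultimately show ?thesis
      by (auto simp: emB mult.commute[of _ "emeasure lborel B"] ennreal_mult_cancel_left)
  qed
  have "\<mu> = lborel" by (rule measure_eqI) (auto simp: eq)
  then show ?thesis by (simp add: \<mu>_def)
qed

lemma space_sphere_measure [simp]: "space sphere_measure = sphere 0 1"
  by (simp add: sphere_measure_def space_restrict_space)

lemma sets_sphere_measure [measurable_cong]:
  "sets sphere_measure = sets (restrict_space borel (sphere 0 1))"
  by (simp add: sphere_measure_def sets_restrict_space)

lemma emeasure_sphere_measure:
  fixes A :: "'a::euclidean_space set"
  assumes A: "A \<in> sets borel" "A \<subseteq> sphere 0 1"
  shows "emeasure sphere_measure A =
      emeasure lborel (cball 0 1 \<inter> sgn -` A) / emeasure lborel (cball (0::'a) 1)"
proof -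
  have [measurable]: "sgn \<in> borel_measurable (borel :: 'a measure)"
    unfolding sgn_div_norm by measurable
  have "sgn -` A \<in> sets borel"
    using measurable_sets[of sgn borel borel A] A(1) by simp
  then show ?thesis
    unfolding sphere_measure_def using A
    by (subst emeasure_restrict_space) (auto simp: emeasure_distr)
qed

lemma emeasure_sphere_measure_space:
  "emeasure sphere_measure (sphere (0::'a::euclidean_space) 1) = 1"
proof -
  have *: "emeasure lborel (cball (0::'a) 1) \<noteq> 0" "emeasure lborel (cball (0::'a) 1) \<noteq> \<infinity>"
    using content_cball_pos[of 1 "0::'a"] emeasure_lborel_cball_finite[of "0::'a" 1]
    by (auto simp: measure_def)
  have "emeasure sphere_measure (sphere (0::'a) 1) =
      emeasure lborel (cball 0 1 \<inter> sgn -` sphere (0::'a) 1) / emeasure lborel (cball (0::'a) 1)"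
    by (rule emeasure_sphere_measure) auto
  also have "sgn -` sphere (0::'a) 1 = - {0}"
    by (auto simp: norm_sgn)
  also have "cball 0 1 \<inter> - {0} = cball 0 1 - {0::'a}" by auto
  also have "emeasure lborel (cball 0 1 - {0::'a}) = emeasure lborel (cball (0::'a) 1)"
    by (intro emeasure_Diff_null_set) auto
  finally show ?thesis using * by (simp add: ennreal_divide_self top.not_eq_extremum)
qed

lemma sphere_measure_invariant:
  fixes T :: "'a::euclidean_space \<Rightarrow> 'a"
  assumes T: "orthogonal_transformation T"
  shows "distr sphere_measure sphere_measure T = sphere_measure"
proof -
  have contT: "continuous_on UNIV T"
    using T by (simp add: orthogonal_transformation_linear linear_continuous_on
      linear_conv_bounded_linear[symmetric])
  have [measurable]: "T \<in> borel_measurable borel"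
    using contT by (rule borel_measurable_continuous_onI)
  have [measurable]: "sgn \<in> borel_measurable (borel :: 'a measure)"
    unfolding sgn_div_norm by measurable
  have TS: "T x \<in> sphere 0 1 \<longleftrightarrow> x \<in> sphere 0 1" for x
    using T by (simp add: orthogonal_transformation_norm)
  have meas: "T \<in> sphere_measure \<rightarrow>\<^sub>M sphere_measure"
    unfolding measurable_cong_sets[OF sets_sphere_measure sets_sphere_measure]
    by (intro measurable_restrict_space2 measurable_restrict_space1)
       (auto simp: space_restrict_space TS[simplified])
  have "emeasure sphere_measure (T -` A \<inter> sphere 0 1) = emeasure sphere_measure A"
    if "A \<in> sets sphere_measure" for A
  proof -
    have A: "A \<in> sets borel" "A \<subseteq> sphere 0 1"
      using that by (auto simp: sets_sphere_measure sets_restrict_space)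
    have sub: "T -` A \<subseteq> sphere 0 1"
      using A TS by blast
    have mT: "T -` A \<in> sets borel"
      using measurable_sets[OF \<open>T \<in> borel_measurable borel\<close> A(1)] by simp
    have sgnT: "sgn (T x) = T (sgn x)" for x
      using T by (simp add: sgn_div_norm orthogonal_transformation_norm
        orthogonal_transformation_linear linear_scale)
    have "cball 0 1 \<inter> sgn -` (T -` A) = T -` (cball 0 1 \<inter> sgn -` A)"
      using T by (auto simp: sgnT orthogonal_transformation_norm)
    moreover have "emeasure lborel (T -` (cball 0 1 \<inter> sgn -` A))
        = emeasure (distr lborel borel T) (cball 0 1 \<inter> sgn -` A)"
      using measurable_sets[OF \<open>sgn \<in> borel_measurable borel\<close> A(1)]
      by (subst emeasure_distr) auto
    ultimately show ?thesis
      using A emeasure_sphere_measure[OF mT sub] emeasure_sphere_measure[OF A] sub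
      by (simp add: Int_absorb2 lborel_distr_orthogonal[OF T])
  qed
  then show ?thesis
    by (intro measure_eqI) (auto simp: emeasure_distr[OF meas])
qed

lemma inner_vec_join:
  "vec_join a b \<bullet> vec_join c d = a \<bullet> c + b \<bullet> d"
  by (simp add: inner_vec_def vec_join_def UNIV_sum[symmetric] sum.UNION_disjoint
      UNIV_Plus_UNIV[symmetric] sum.Plus del: UNIV_Plus_UNIV)

lemma norm_vec_join: "(norm (vec_join a b))\<^sup>2 = (norm a)\<^sup>2 + (norm b)\<^sup>2"
  by (simp add: power2_norm_eq_inner inner_vec_join)

lemma vec_join_cases: obtains a b where "x = vec_join a b"
proof
  show "x = vec_join (\<chi> i. x $ Inl i) (\<chi> i. x $ Inr i)"
    by (simp add: vec_eq_iff vec_join_def split: sum.split)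
qed

lemma vec_join_inject [simp]: "vec_join a b = vec_join c d \<longleftrightarrow> a = c \<and> b = d"
proof
  assume eq: "vec_join a b = vec_join c d"
  have "a $ i = c $ i" for i using arg_cong[OF eq, of "\<lambda>x. x $ Inl i"] by (simp add: vec_join_def)
  moreover have "b $ i = d $ i" for i
    using arg_cong[OF eq, of "\<lambda>x. x $ Inr i"] by (simp add: vec_join_def)
  ultimately show "a = c \<and> b = d" by (simp add: vec_eq_iff)
qed auto

lemma vec_join_add: "vec_join (a + c) (b + d) = vec_join a b + vec_join c d"
  by (simp add: vec_eq_iff vec_join_def split: sum.split)

lemma vec_join_scaleR: "vec_join (t *\<^sub>R a) (t *\<^sub>R b) = t *\<^sub>R vec_join a b"
  by (simp add: vec_eq_iff vec_join_def split: sum.split)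

lemma stiefel_base_mult: "stiefel_base *v y = vec_join 0 y"
  by (auto simp: vec_eq_iff stiefel_base_def vec_join_def matrix_vector_mult_def mat_def
      if_distrib[where f = "\<lambda>x. x * _"] cong: if_cong split: sum.split)

lemma stiefel_rotation_exists:
  fixes v :: "real ^ 'q ^ ('p::finite + 'q::finite)"
  assumes v: "v \<in> stiefel"
  shows "\<exists>r. orthogonal_matrix r \<and> r ** stiefel_base = v"
proof -
  have vv: "(v *v x) \<bullet> (v *v y) = x \<bullet> y" for x y
  proof -
    have "(v *v x) \<bullet> (v *v y) = ((v *v x) v* v) \<bullet> y"
      by (simp only: dot_lmul_matrix)
    also have "(v *v x) v* v = (transpose v ** v) *v x"
      by (simp only: transpose_matrix_vector[symmetric] matrix_vector_mul_assoc)
    finally show ?thesis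
      using v by (simp add: stiefel_def)
  qed
  let ?j = "\<lambda>a :: real ^ 'p. vec_join a (0 :: real ^ 'q)"
  let ?S = "range ?j"
  define W where "W = {x. \<forall>y\<in>range ((*v) v). orthogonal y x}"
  have linj: "linear ?j"
    using vec_join_add[of _ _ 0 0] vec_join_scaleR[of _ _ 0] by (intro linearI) auto
  have injj: "inj ?j" by (auto intro!: injI)
  have subS: "subspace ?S" using linj by (intro linear_subspace_image subspace_UNIV)
  have subV: "subspace (range ((*v) v))"
    by (intro linear_subspace_image subspace_UNIV) simp
  have subW: "subspace W"
    unfolding W_def by (rule subspace_orthogonal_to_vectors)
  have injv: "inj ((*v) v)"
  proof (rule injI)
    fix x y assume "v *v x = v *v y"
    then have "(x - y) \<bullet> (x - y) = 0"
      using vv[of "x - y" "x - y"] by (simp add: matrix_vector_mult_diff_distrib)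
    then show "x = y" by simp
  qed
  have dimS: "dim ?S = CARD('p)"
    using dim_image_eq[OF linj, of UNIV] injj by (simp add: dim_UNIV inj_on_def)
  have dimV: "dim (range ((*v) v)) = CARD('q)"
    using dim_image_eq[of "(*v) v" UNIV] injv by (simp add: dim_UNIV inj_on_def)
  have "dim W + dim (range ((*v) v)) = dim (UNIV :: (real ^ ('p::finite + 'q::finite)) set)"
    using dim_subspace_orthogonal_to_vectors[OF subV subspace_UNIV]
    by (simp add: W_def)
  then have "dim ?S = dim W" using dimS dimV by (simp add: dim_UNIV)
  then obtain g where g: "linear g" "g ` ?S = W" "\<And>x. x \<in> ?S \<Longrightarrow> norm (g x) = norm x"
    using isometries_subspaces[OF subS subW] by metis
  define L where "L x = (\<chi> i. x $ Inl i)" for x :: "real ^ ('p::finite + 'q::finite)"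
  define R where "R x = (\<chi> i. x $ Inr i)" for x :: "real ^ ('p::finite + 'q::finite)"
  define h where "h x = g (vec_join (L x) 0) + v *v R x" for x
  have linh: "linear h"
  proof (rule linearI)
    fix x y
    have "vec_join (L (x + y)) (0 :: real ^ 'q) = vec_join (L x) 0 + vec_join (L y) 0"
      by (simp add: L_def vec_eq_iff vec_join_def split: sum.split)
    moreover have "R (x + y) = R x + R y" by (simp add: R_def vec_eq_iff)
    ultimately show "h (x + y) = h x + h y"
      by (simp add: h_def linear_add[OF g(1)] matrix_vector_right_distrib)
  next
    fix c x
    have "vec_join (L (c *\<^sub>R x)) (0 :: real ^ 'q) = c *\<^sub>R vec_join (L x) 0"
      by (simp add: L_def vec_eq_iff vec_join_def split: sum.split)
    moreover have "R (c *\<^sub>R x) = c *\<^sub>R R x" by (simp add: R_def vec_eq_iff)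
    ultimately show "h (c *\<^sub>R x) = c *\<^sub>R h x"
      by (simp add: h_def linear_scale[OF g(1)] matrix_vector_mult_scaleR scaleR_right_distrib)
  qed
  have "norm (h x) = norm x" for x
  proof -
    have "g (vec_join (L x) 0) \<in> W" using g(2) by blast
    then have "orthogonal (g (vec_join (L x) 0)) (v *v R x)"
      unfolding W_def using orthogonal_commute by blast
    then have "(norm (h x))\<^sup>2 = (norm (g (vec_join (L x) 0)))\<^sup>2 + (norm (v *v R x))\<^sup>2"
      unfolding h_def by (rule norm_add_Pythagorean)
    also have "norm (g (vec_join (L x) 0)) = norm (vec_join (L x) (0 :: real ^ 'q))"
      by (rule g(3)) auto
    also have "(norm (vec_join (L x) (0 :: real ^ 'q)))\<^sup>2 = (norm (L x))\<^sup>2"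
      by (simp add: norm_vec_join)
    also have "(norm (v *v R x))\<^sup>2 = (norm (R x))\<^sup>2"
      by (simp add: power2_norm_eq_inner vv)
    also have "(norm (L x))\<^sup>2 + (norm (R x))\<^sup>2 = (norm (vec_join (L x) (R x)))\<^sup>2"
      by (simp add: norm_vec_join)
    also have "vec_join (L x) (R x) = x"
      by (simp add: vec_eq_iff L_def R_def vec_join_def split: sum.split)
    finally show ?thesis by simp
  qed
  then have "orthogonal_transformation h"
    using linh by (simp add: orthogonal_transformation)
  then have orth: "orthogonal_matrix (matrix h)"
    by (simp add: orthogonal_transformation_matrix)
  have "(matrix h ** stiefel_base) *v y = v *v y" for y
  proof -
    have "(matrix h ** stiefel_base) *v y = h (vec_join 0 y)"
      by (simp add: matrix_vector_mul_assoc[symmetric] stiefel_base_mult matrix_works linh)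
    also have "L (vec_join 0 y) = 0" "R (vec_join 0 y) = y"
      by (simp_all add: L_def R_def vec_join_def vec_eq_iff)
    then have "h (vec_join 0 y) = g (vec_join 0 0) + v *v y" by (simp add: h_def)
    also have "vec_join 0 0 = (0 :: real ^ ('p::finite + 'q::finite))"
      by (simp add: vec_join_def vec_eq_iff split: sum.split)
    finally show ?thesis by (simp add: linear_0[OF g(1)])
  qed
  then have "matrix h ** stiefel_base = v" by (simp add: matrix_eq)
  with orth show ?thesis by blast
qed

lemma bispherical_integral_cong:
  fixes r r' :: "real ^ ('p::finite + 'q::finite) ^ ('p::finite + 'q::finite)"
  assumes r: "orthogonal_matrix r" and r': "orthogonal_matrix r'"
    and eq: "r ** stiefel_base = r' ** stiefel_base"
    and f: "f \<in> borel_measurable sphere_measure" and \<tau>: "\<tau> \<in> {0..1}"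
  shows "bispherical_integral r \<tau> f = bispherical_integral r' \<tau> f"
proof -
  define q where "q = transpose r ** r'"
  have q: "orthogonal_matrix q"
    unfolding q_def using r r' by (simp add: orthogonal_matrix_mul orthogonal_matrix_transpose)
  have rq: "r ** q = r'"
    using r by (simp add: q_def matrix_mul_assoc orthogonal_matrix_def)
  have "q ** stiefel_base = (stiefel_base :: real ^ 'q ^ ('p::finite + 'q::finite))"
  proof -
    have "q ** stiefel_base = transpose r ** (r' ** stiefel_base)"
      by (simp add: q_def matrix_mul_assoc)
    also have "\<dots> = (transpose r ** r) ** stiefel_base"
      by (simp add: eq[symmetric] matrix_mul_assoc)
    finally show ?thesis
      using r by (simp add: orthogonal_matrix_def)
  qed
  then have qb: "q *v vec_join 0 b = vec_join 0 b" for b :: "real ^ 'q"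
    by (metis stiefel_base_mult matrix_vector_mul_assoc)
  have qot: "orthogonal_transformation ((*v) q)"
    using q by (simp add: orthogonal_transformation_matrix)
  define \<alpha> where "\<alpha> a = (\<chi> i. (q *v vec_join a 0) $ Inl i)" for a :: "real ^ 'p"
  have \<alpha>: "q *v vec_join a 0 = vec_join (\<alpha> a) (0 :: real ^ 'q)" for a
  proof -
    obtain c d where cd: "q *v vec_join a (0 :: real ^ 'q) = vec_join c d"
      by (rule vec_join_cases)
    have "vec_join c d \<bullet> vec_join 0 d = vec_join a 0 \<bullet> vec_join 0 d"
      using qot cd qb[of d] unfolding orthogonal_transformation_def by metis
    then have "d = 0" by (simp add: inner_vec_join)
    moreover have "\<alpha> a = c"
      unfolding \<alpha>_def cd by (simp add: vec_join_def vec_eq_iff)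
    ultimately show ?thesis using cd by simp
  qed
  have qab: "q *v vec_join a b = vec_join (\<alpha> a) b" for a and b :: "real ^ 'q"
    using vec_join_add[of a 0 0 b] vec_join_add[of "\<alpha> a" 0 0 b] \<alpha>[of a] qb[of b]
    by (simp add: matrix_vector_right_distrib)
  have \<alpha>ot: "orthogonal_transformation \<alpha>"
    unfolding orthogonal_transformation
  proof (intro conjI allI linearI)
    fix a b c
    have "vec_join (\<alpha> (a + b)) (0 :: real ^ 'q) = vec_join (\<alpha> a + \<alpha> b) 0"
      using vec_join_add[of a b "0 :: real ^ 'q" 0] vec_join_add[of "\<alpha> a" "\<alpha> b" "0 :: real ^ 'q" 0]
      by (simp add: \<alpha>[symmetric] matrix_vector_right_distrib)
    then show "\<alpha> (a + b) = \<alpha> a + \<alpha> b" by simp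
    have "vec_join (\<alpha> (c *\<^sub>R a)) (0 :: real ^ 'q) = vec_join (c *\<^sub>R \<alpha> a) 0"
      using vec_join_scaleR[of c a "0 :: real ^ 'q"] vec_join_scaleR[of c "\<alpha> a" "0 :: real ^ 'q"]
      by (simp add: \<alpha>[symmetric] matrix_vector_mult_scaleR)
    then show "\<alpha> (c *\<^sub>R a) = c *\<^sub>R \<alpha> a" by simp
    have "(norm (\<alpha> a))\<^sup>2 = (norm (q *v vec_join a (0 :: real ^ 'q)))\<^sup>2"
      by (simp add: \<alpha> norm_vec_join)
    also have "\<dots> = (norm a)\<^sup>2"
      using qot by (simp add: orthogonal_transformation_norm norm_vec_join)
    finally show "norm (\<alpha> a) = norm a" by simp
  qed
  have contr: "continuous_on UNIV ((*v) r)"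
    by (simp add: linear_continuous_on linear_conv_bounded_linear[symmetric])
  have rn: "norm (r *v x) = norm x" for x
    using r orthogonal_transformation_norm[of "(*v) r"] by (simp add: orthogonal_transformation_matrix)
  have "(LINT \<eta>|sphere_measure. f (r *v vec_join (sqrt (1 - \<tau>\<^sup>2) *\<^sub>R \<eta>) (\<tau> *\<^sub>R \<zeta>)))
      = (LINT \<eta>|sphere_measure. f (r' *v vec_join (sqrt (1 - \<tau>\<^sup>2) *\<^sub>R \<eta>) (\<tau> *\<^sub>R \<zeta>)))"
    (is "(LINT \<eta>|_. ?F \<eta>) = _")
    if \<zeta>: "\<zeta> \<in> space sphere_measure" for \<zeta> :: "real ^ 'q"
  proof -
    let ?u = "\<lambda>\<eta>. r *v vec_join (sqrt (1 - \<tau>\<^sup>2) *\<^sub>R \<eta>) (\<tau> *\<^sub>R \<zeta>)"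
    have "continuous_on UNIV (\<lambda>\<eta> :: real ^ 'p. vec_join (sqrt (1 - \<tau>\<^sup>2) *\<^sub>R \<eta>) (\<tau> *\<^sub>R \<zeta>))"
      unfolding vec_join_def
    proof (rule continuous_on_vec_lambda)
      fix i :: "'p + 'q"
      show "continuous_on UNIV (\<lambda>\<eta> :: real ^ 'p.
          case i of Inl a \<Rightarrow> (sqrt (1 - \<tau>\<^sup>2) *\<^sub>R \<eta>) $ a | Inr b \<Rightarrow> (\<tau> *\<^sub>R \<zeta>) $ b)"
        by (cases i) (auto intro!: continuous_intros)
    qed
    then have "continuous_on UNIV ?u"
      using continuous_on_compose2[OF contr] by blast
    then have mu: "?u \<in> borel_measurable borel"
      by (rule borel_measurable_continuous_onI)
    have "\<tau>\<^sup>2 \<le> 1" using \<tau> by (simp add: power_le_one)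
    then have nu: "norm (?u \<eta>) = 1" if "norm \<eta> = 1" for \<eta>
    proof -
      have "(norm (?u \<eta>))\<^sup>2 = 1"
        using that \<zeta> \<open>\<tau>\<^sup>2 \<le> 1\<close> by (simp add: rn norm_vec_join power_mult_distrib)
      then show ?thesis by (simp add: power2_eq_1_iff)
        (metis norm_ge_zero not_one_le_zero neg_0_le_iff_le)
    qed
    have "?u \<in> sphere_measure \<rightarrow>\<^sub>M sphere_measure"
      unfolding measurable_cong_sets[OF sets_sphere_measure sets_sphere_measure]
      using mu nu
      by (intro measurable_restrict_space2 measurable_restrict_space1)
         (auto simp: space_restrict_space)
    then have F: "?F \<in> borel_measurable sphere_measure"
      using f by (rule measurable_compose)
    have m\<alpha>: "\<alpha> \<in> sphere_measure \<rightarrow>\<^sub>M sphere_measure"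
    proof -
      have "\<alpha> \<in> borel_measurable borel"
        using \<alpha>ot by (intro borel_measurable_continuous_onI)
          (simp add: orthogonal_transformation_linear linear_continuous_on
            linear_conv_bounded_linear[symmetric])
      then show ?thesis
        unfolding measurable_cong_sets[OF sets_sphere_measure sets_sphere_measure]
        using \<alpha>ot by (intro measurable_restrict_space2 measurable_restrict_space1)
         (auto simp: space_restrict_space orthogonal_transformation_norm)
    qed
    have "(LINT \<eta>|sphere_measure. ?F \<eta>) = (LINT \<eta>|distr sphere_measure sphere_measure \<alpha>. ?F \<eta>)"
      by (simp add: sphere_measure_invariant[OF \<alpha>ot])
    also have "\<dots> = (LINT \<eta>|sphere_measure. ?F (\<alpha> \<eta>))"
      by (rule integral_distr[OF m\<alpha> F])
    also have "(\<lambda>\<eta>. ?F (\<alpha> \<eta>)) = (\<lambda>\<eta>. f (r' *v vec_join (sqrt (1 - \<tau>\<^sup>2) *\<^sub>R \<eta>) (\<tau> *\<^sub>R \<zeta>)))"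
      using linear_scale[OF orthogonal_transformation_linear[OF \<alpha>ot]]
      by (simp add: rq[symmetric] matrix_vector_mul_assoc[symmetric] qab)
    finally show ?thesis .
  qed
  then show ?thesis
    unfolding bispherical_integral_def by (rule Bochner_Integration.integral_cong[OF refl])
qed

lemma bispherical_mean_eq:
  fixes r :: "real ^ ('p::finite + 'q::finite) ^ ('p::finite + 'q::finite)"
  assumes "orthogonal_matrix r" "r ** stiefel_base = v"
    and "f \<in> borel_measurable sphere_measure" "\<tau> \<in> {0..1}"
  shows "bispherical_mean \<tau> f v = bispherical_integral r \<tau> f"
proof -
  let ?P = "\<lambda>r. orthogonal_matrix r \<and> r ** stiefel_base = v"
  have "?P (SOME r. ?P r)" using assms(1,2) by (intro someI[of ?P r]) simp
  then show ?thesis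
    unfolding bispherical_mean_def using assms by (intro bispherical_integral_cong) auto
qed

end

theory Submission
  imports Defs
begin

text \<open>
  After a rotation \<open>v\<close> is the standard frame, since harmonicity and surface measure are invariant, and \<open>Y\<close>
  is the restriction of a harmonic homogeneous polynomial \<open>P\<close> of degree \<open>j\<close> on \<open>\<real>\<^sup>p \<times> \<real>\<^sup>q\<close> with \<open>p = k + 1\<close>
  and \<open>q = n - k\<close>. Both sides of the theorem turn out to be explicit multiples of one number, the iterated
  partial Laplacian \<open>T\<close> of \<open>P\<close> in the second block of variables.

  The left side is a double sphere mean. Pizzetti's formula (\<open>pizzetti\<close>) expresses the mean of a polynomial
  over a sphere about the origin by the iterated Laplacians at the origin. For odd \<open>j\<close> every term has odd
  degree in one of the blocks, and the mean is zero. For \<open>j = 2 * m\<close> the formula, applied in both blocks, leaves the numbers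
  \<open>\<Delta>\<^sub>1\<^sup>i \<Delta>\<^sub>2\<^sup>m\<^sup>-\<^sup>i P\<close>. Since \<open>\<Delta>\<^sub>1 P = - \<Delta>\<^sub>2 P\<close>, each of them equals \<open>(- 1)\<^sup>i T\<close>, and the remaining sum in
  \<open>\<tau>\<close> is, up to a constant, the expansion of the Jacobi polynomial in powers of \<open>(t - 1) / 2\<close> and
  \<open>(t + 1) / 2\<close> (\<open>bispherical_mean_jacobi\<close>).

  The right side contains the mean over the whole sphere of \<open>P\<close> against a Jacobi polynomial in the squared
  norm of the second block. On the sphere that Jacobi polynomial is a homogeneous polynomial of the same
  degree \<open>2 * m\<close> in the squared block norms. Against a harmonic polynomial, multiplication by a coordinate is the
  transpose of differentiation up to a constant (\<open>harmonic_coord_transpose\<close>), so each product of powers of squared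
  block norms turns into the corresponding product of partial Laplacians. Harmonicity again
  reduces all of them to \<open>T\<close>, and the coefficients are summed by Vandermonde's identity
  (\<open>jacobi_harmonic_mean\<close>). Bispherical coordinates and the orthogonality of Jacobi polynomials are thereby
  replaced by algebra. What remains is an identity between Gamma values
  (\<open>varkappa_normalization\<close>).

  Both facts about sphere means rest on the integration by parts formula \<open>sphere_mean_by_parts\<close>, which is
  the infinitesimal form of the rotation invariance of surface measure.
\<close>

section \<open>Partial derivatives of polynomial functions\<close>

abbreviation "D \<equiv> partial_derivative"

text \<open>
  The full Laplacian is the case \<open>B = Basis\<close>; the cases where
  \<open>B\<close> is one of the two coordinate blocks of \<open>\<real>\<^sup>n\<^sup>+\<^sup>1\<close> carry the argument.
\<close>
definition lap :: "'a set \<Rightarrow> ('a::euclidean_space \<Rightarrow> 'b::real_normed_vector) \<Rightarrow> 'a \<Rightarrow> 'b" where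
  "lap B f x = (\<Sum>b\<in>B. D b (D b f) x)"

definition homog :: "nat \<Rightarrow> ('a::real_vector \<Rightarrow> 'b::real_vector) \<Rightarrow> bool" where
  "homog d f \<longleftrightarrow> (\<forall>t x. f (t *\<^sub>R x) = t ^ d *\<^sub>R f x)"

text \<open>
  Vector-valued functions have no product, so induction over the generation of polynomials has to
  multiply by one coordinate at a time. This works because an arbitrary real polynomial factor is
  itself built from coordinates.
\<close>
lemma polynomial_function_induct [consumes 1, case_names const add scale mult]:
  fixes f :: "'a::euclidean_space \<Rightarrow> 'b::euclidean_space"
  assumes f: "polynomial_function f"
    and const: "\<And>c. P (\<lambda>x. c)"
    and add: "\<And>f g. polynomial_function f \<Longrightarrow> polynomial_function g \<Longrightarrow> P f \<Longrightarrow> P g \<Longrightarrow> P (\<lambda>x. f x + g x)"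
    and scale: "\<And>c f. polynomial_function f \<Longrightarrow> P f \<Longrightarrow> P (\<lambda>x. c *\<^sub>R f x)"
    and mult: "\<And>u f. polynomial_function f \<Longrightarrow> P f \<Longrightarrow> P (\<lambda>x. (x \<bullet> u) *\<^sub>R f x)"
  shows "P f"
proof -
  let ?P = "\<lambda>f. polynomial_function f \<and> P f"
  have inner_pf: "polynomial_function (\<lambda>x::'a. x \<bullet> u)" for u
    by (simp add: polynomial_function_bounded_linear bounded_linear_inner_left)
  have sum: "?P (\<lambda>x. \<Sum>i\<in>I. F i x)" if "finite I" "\<And>i. i \<in> I \<Longrightarrow> ?P (F i)" for I and F :: "'c \<Rightarrow> 'a \<Rightarrow> 'b"
    using that by (induction I rule: finite_induct) (auto intro: const add)
  have mul: "?P (\<lambda>x. r x *\<^sub>R g x)" if "real_polynomial_function r" "?P g" for r g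
    using that
  proof (induction r arbitrary: g rule: real_polynomial_function.induct)
    case (linear h)
    have h: "h x = (\<Sum>u\<in>Basis. h u * (x \<bullet> u))" for x
      using Linear_Algebra.linear_componentwise[of h x 1] linear(1)
      by (simp add: bounded_linear.linear mult.commute)
    have "(\<lambda>x. h x *\<^sub>R g x) = (\<lambda>x. \<Sum>u\<in>Basis. h u *\<^sub>R ((x \<bullet> u) *\<^sub>R g x))"
      by (subst h) (simp add: scaleR_sum_left)
    moreover have "?P (\<lambda>x. \<Sum>u\<in>Basis. h u *\<^sub>R ((x \<bullet> u) *\<^sub>R g x))"
    proof (rule sum)
      fix u :: 'a
      have "?P (\<lambda>x. (x \<bullet> u) *\<^sub>R g x)"
        using linear(2) mult polynomial_function_mult[OF inner_pf] by blast
      then show "?P (\<lambda>x. h u *\<^sub>R ((x \<bullet> u) *\<^sub>R g x))"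
        using scale polynomial_function_cmul by blast
    qed simp
    ultimately show ?case by metis
  next
    case (const c) then show ?case by (auto intro: scale)
  next
    case (add f h)
    then have "?P (\<lambda>x. f x *\<^sub>R g x)" "?P (\<lambda>x. h x *\<^sub>R g x)" by blast+
    then show ?case
      unfolding scaleR_add_left using assms(3) polynomial_function_add by blast
  next
    case (mult f h)
    then have "?P (\<lambda>x. f x *\<^sub>R (h x *\<^sub>R g x))" by blast
    then show ?case by simp
  qed
  have "?P (\<lambda>x. \<Sum>b\<in>Basis. (f x \<bullet> b) *\<^sub>R b)"
  proof (intro sum)
    fix b :: 'b assume "b \<in> Basis"
    have "real_polynomial_function (\<lambda>x. f x \<bullet> b)"
      using f by (auto simp: polynomial_function_iff_Basis_inner \<open>b \<in> Basis\<close>)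
    then show "?P (\<lambda>x. (f x \<bullet> b) *\<^sub>R b)" by (intro mul) (auto intro: const)
  qed auto
  then show ?thesis by (simp add: euclidean_representation)
qed

lemma partial_derivative_eq:
  assumes "(f has_derivative f') (at x)"
  shows "D b f x = f' b"
proof -
  have "((\<lambda>t. f (x + t *\<^sub>R b)) has_derivative (\<lambda>t. f' (t *\<^sub>R b))) (at 0)"
    by (rule has_derivative_compose[where g = f and f = "\<lambda>t. x + t *\<^sub>R b" and f' = "\<lambda>t. t *\<^sub>R b"])
      (use assms in \<open>auto intro!: derivative_eq_intros\<close>)
  moreover have "(\<lambda>t. f' (t *\<^sub>R b)) = (\<lambda>t. t *\<^sub>R f' b)"
    using has_derivative_linear[OF assms] by (simp add: linear_scale)
  ultimately show ?thesis
    unfolding partial_derivative_def by (intro vector_derivative_at) (simp add: has_vector_derivative_def)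
qed

lemma polynomial_has_derivative:
  fixes f :: "'a::euclidean_space \<Rightarrow> 'b::euclidean_space"
  assumes "polynomial_function f"
  shows "(f has_derivative (\<lambda>h. D h f x)) (at x)"
proof -
  obtain f' where "(f has_derivative f') (at x)"
    using differentiable_at_polynomial_function[OF assms] by (auto simp: differentiable_def)
  with partial_derivative_eq[OF this] show ?thesis by simp
qed

lemma D_sum_direction:
  fixes f :: "'a::euclidean_space \<Rightarrow> 'b::euclidean_space"
  assumes "polynomial_function f"
  shows "D (\<Sum>i\<in>I. c i *\<^sub>R w i) f x = (\<Sum>i\<in>I. c i *\<^sub>R D (w i) f x)"
  using has_derivative_linear[OF polynomial_has_derivative[OF assms, of x]]
  by (simp add: linear_sum[where f = "\<lambda>h. D h f x"] linear_scale[where f = "\<lambda>h. D h f x"])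

lemma D_const [simp]: "D b (\<lambda>x. c) = (\<lambda>x. 0)"
  by (rule ext, rule partial_derivative_eq[where f' = "\<lambda>h. 0"]) simp

lemma D_coord [simp]: "D b (\<lambda>x. x \<bullet> u) = (\<lambda>x. b \<bullet> u)"
  by (rule ext, rule partial_derivative_eq[where f' = "\<lambda>h. h \<bullet> u"]) (auto intro!: derivative_eq_intros)

lemma polynomial_function_coord [intro]: "polynomial_function (\<lambda>x::'a::euclidean_space. x \<bullet> u)"
  by (simp add: polynomial_function_bounded_linear bounded_linear_inner_left)

lemma D_add:
  fixes f g :: "'a::euclidean_space \<Rightarrow> 'b::euclidean_space"
  assumes "polynomial_function f" "polynomial_function g"
  shows "D b (\<lambda>x. f x + g x) = (\<lambda>x. D b f x + D b g x)"
  by (intro ext partial_derivative_eq[where f' = "\<lambda>b. D b f x + D b g x" for x]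
    derivative_intros polynomial_has_derivative assms)

lemma D_scale:
  fixes f :: "'a::euclidean_space \<Rightarrow> 'b::euclidean_space"
  assumes "polynomial_function f"
  shows "D b (\<lambda>x. c *\<^sub>R f x) = (\<lambda>x. c *\<^sub>R D b f x)"
  by (intro ext partial_derivative_eq[where f' = "\<lambda>b. c *\<^sub>R D b f x" for x]
    derivative_intros polynomial_has_derivative assms)

lemma D_mult:
  fixes f :: "'a::euclidean_space \<Rightarrow> 'b::euclidean_space" and r :: "'a \<Rightarrow> real"
  assumes "polynomial_function r" "polynomial_function f"
  shows "D b (\<lambda>x. r x *\<^sub>R f x) = (\<lambda>x. r x *\<^sub>R D b f x + D b r x *\<^sub>R f x)"
  by (intro ext partial_derivative_eq[where f' = "\<lambda>b. r x *\<^sub>R D b f x + D b r x *\<^sub>R f x" for x]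
    derivative_intros polynomial_has_derivative assms)

lemma D_coord_mult:
  fixes f :: "'a::euclidean_space \<Rightarrow> 'b::euclidean_space"
  assumes "polynomial_function f"
  shows "D b (\<lambda>x. (x \<bullet> u) *\<^sub>R f x) = (\<lambda>x. (x \<bullet> u) *\<^sub>R D b f x + (b \<bullet> u) *\<^sub>R f x)"
  by (subst D_mult) (auto simp: assms)

lemma D_sum:
  fixes f :: "'i \<Rightarrow> 'a::euclidean_space \<Rightarrow> 'b::euclidean_space"
  assumes "finite I" "\<And>i. i \<in> I \<Longrightarrow> polynomial_function (f i)"
  shows "D b (\<lambda>x. \<Sum>i\<in>I. f i x) = (\<lambda>x. \<Sum>i\<in>I. D b (f i) x)"
  using assms by (induction I rule: finite_induct) (auto simp: D_add polynomial_function_sum)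

lemma polynomial_function_D [intro]:
  fixes f :: "'a::euclidean_space \<Rightarrow> 'b::euclidean_space"
  assumes "polynomial_function f"
  shows "polynomial_function (D b f)"
  using assms
proof (induction rule: polynomial_function_induct)
  case (mult u f)
  then show ?case
    unfolding D_coord_mult[OF mult(1)]
    by (intro polynomial_function_add polynomial_function_cmul polynomial_function_mult polynomial_function_coord)
qed (simp_all add: D_add D_scale polynomial_function_add polynomial_function_cmul)

lemma D_commute:
  fixes f :: "'a::euclidean_space \<Rightarrow> 'b::euclidean_space"
  assumes "polynomial_function f"
  shows "D a (D b f) = D b (D a f)"
  using assms
proof (induction rule: polynomial_function_induct)
  case (mult u f)
  have *: "D a (D b (\<lambda>x. (x \<bullet> u) *\<^sub>R f x)) =
      (\<lambda>x. (x \<bullet> u) *\<^sub>R D a (D b f) x + (a \<bullet> u) *\<^sub>R D b f x + (b \<bullet> u) *\<^sub>R D a f x)" for a b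
    using mult(1) by (simp add: D_coord_mult D_add D_scale polynomial_function_D polynomial_function_mult
        polynomial_function_cmul polynomial_function_coord)
  show ?case
    by (simp only: * mult(2)) (simp add: ac_simps)
qed (simp_all add: D_add D_scale polynomial_function_D)

lemma D_affine:
  assumes "linear L"
  shows "D b (\<lambda>x. f (a + L x)) = (\<lambda>x. D (L b) f (a + L x))"
  using assms by (simp add: partial_derivative_def fun_eq_iff linear_add linear_scale add.assoc)

lemma polynomial_function_lap [intro]:
  fixes f :: "'a::euclidean_space \<Rightarrow> 'b::euclidean_space"
  shows "polynomial_function f \<Longrightarrow> polynomial_function (lap B f)"
  unfolding lap_def[abs_def] by (cases "finite B") (auto intro!: polynomial_function_sum)

lemma D_lap:
  fixes f :: "'a::euclidean_space \<Rightarrow> 'b::euclidean_space"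
  assumes "polynomial_function f"
  shows "D b (lap B f) = lap B (D b f)"
proof (cases "finite B")
  case True
  then show ?thesis
    unfolding lap_def[abs_def] using assms by (simp add: D_sum polynomial_function_D D_commute[of _ b])
qed (simp add: lap_def[abs_def])

lemma lap_add:
  fixes f g :: "'a::euclidean_space \<Rightarrow> 'b::euclidean_space"
  assumes "polynomial_function f" "polynomial_function g"
  shows "lap B (\<lambda>x. f x + g x) = (\<lambda>x. lap B f x + lap B g x)"
  using assms by (simp add: lap_def[abs_def] D_add polynomial_function_D sum.distrib)

lemma lap_affine:
  assumes "linear L" "inj_on L B"
  shows "lap B (\<lambda>x. f (a + L x)) = (\<lambda>x. lap (L ` B) f (a + L x))"
  using assms by (simp add: lap_def[abs_def] D_affine sum.reindex)

section \<open>Homogeneous polynomials\<close>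

lemma homogD: "homog d f \<Longrightarrow> f (t *\<^sub>R x) = t ^ d *\<^sub>R f x"
  by (simp add: homog_def)

text \<open>
  Homogeneity of a derivative comes out of a computation that divides by the scaling factor \<open>t\<close>;
  continuity supplies the missing value \<open>t = 0\<close>.
\<close>
lemma homogI_nonzero:
  fixes f :: "'a::euclidean_space \<Rightarrow> 'b::euclidean_space"
  assumes "polynomial_function f" "\<And>t x. t \<noteq> 0 \<Longrightarrow> f (t *\<^sub>R x) = t ^ d *\<^sub>R f x"
  shows "homog d f"
  unfolding homog_def
proof (intro allI)
  fix t x
  have "isCont f 0" by (rule continuous_polymonial_function[OF assms(1)])
  then have 1: "((\<lambda>t. f (t *\<^sub>R x)) \<longlongrightarrow> f 0) (at 0)"
    by (rule isCont_tendsto_compose) (auto intro!: tendsto_eq_intros)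
  have 2: "((\<lambda>t. t ^ d *\<^sub>R f x) \<longlongrightarrow> 0 ^ d *\<^sub>R f x) (at 0)"
    by (intro tendsto_intros)
  have "\<forall>\<^sub>F t in at 0. f (t *\<^sub>R x) = t ^ d *\<^sub>R f x"
    using assms(2) by (auto simp: eventually_at_filter)
  with 2 have "((\<lambda>t. f (t *\<^sub>R x)) \<longlongrightarrow> 0 ^ d *\<^sub>R f x) (at 0)"
    by (simp add: tendsto_cong)
  with 1 have "f 0 = 0 ^ d *\<^sub>R f x"
    by (rule tendsto_unique[rotated]) simp
  then show "f (t *\<^sub>R x) = t ^ d *\<^sub>R f x"
    using assms(2) by (cases "t = 0") auto
qed

lemma homog_0: "homog 0 f \<Longrightarrow> f x = f 0"
  using homogD[of 0 f 0 x] by simp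

lemma homog_Suc_at_0: "homog d f \<Longrightarrow> d > 0 \<Longrightarrow> f 0 = 0"
  using homogD[of d f 0 0] by (simp add: power_0_left)

lemma D_homog_0: "homog 0 f \<Longrightarrow> D b f = (\<lambda>x. 0)"
proof -
  assume "homog 0 f"
  then have "f = (\<lambda>x. f 0)" using homog_0 by blast
  then show ?thesis by (metis D_const)
qed

text \<open>
  For \<open>d = 0\<close> the derivative vanishes and is homogeneous of every degree, so the truncated
  subtraction \<open>d - 1\<close> does no harm. The same remark applies to \<open>d - 2\<close> and \<open>d - 2 * i\<close> for Laplacians.
\<close>
lemma homog_D:
  fixes f :: "'a::euclidean_space \<Rightarrow> 'b::euclidean_space"
  assumes f: "polynomial_function f" and h: "homog d f"
  shows "homog (d - 1) (D b f)"
proof (cases d)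
  case 0
  with D_homog_0[of f b] h show ?thesis by (simp add: homog_def)
next
  case (Suc e)
  show ?thesis
  proof (rule homogI_nonzero)
    fix t :: real and x assume t: "t \<noteq> 0"
    have lin: "linear ((*\<^sub>R) t :: 'a \<Rightarrow> 'a)" by (rule linear_scale_self)
    have "(\<lambda>x. t ^ d *\<^sub>R D b f x) = D b (\<lambda>x. f (t *\<^sub>R x))"
      unfolding homogD[OF h] D_scale[OF f] ..
    also have "\<dots> = (\<lambda>x. D (t *\<^sub>R b) f (t *\<^sub>R x))"
      using D_affine[OF lin, of b f 0] by simp
    also have "\<dots> = (\<lambda>x. t *\<^sub>R D b f (t *\<^sub>R x))"
      using D_sum_direction[OF f, of "\<lambda>_. t" "\<lambda>_. b" "{0::nat}"] by simp
    finally have "t *\<^sub>R D b f (t *\<^sub>R x) = t ^ d *\<^sub>R D b f x" by metis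
    then show "D b f (t *\<^sub>R x) = t ^ (d - 1) *\<^sub>R D b f x"
      using t Suc by (auto simp flip: scaleR_scaleR)
  qed (use f in auto)
qed

lemma homog_lap:
  fixes f :: "'a::euclidean_space \<Rightarrow> 'b::euclidean_space"
  assumes "polynomial_function f" "homog d f"
  shows "homog (d - 2) (lap B f)"
proof -
  have "homog (d - 2) (D b (D b f))" for b
    using homog_D[OF _ homog_D[OF assms, of b], of b] assms(1) by (auto simp: numeral_2_eq_2)
  then show ?thesis by (simp add: homog_def lap_def scaleR_sum_right)
qed

lemma euler_identity:
  fixes f :: "'a::euclidean_space \<Rightarrow> 'b::euclidean_space"
  assumes f: "polynomial_function f" and h: "homog d f"
  shows "(\<Sum>b\<in>Basis. (x \<bullet> b) *\<^sub>R D b f x) = real d *\<^sub>R f x"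
proof -
  \<comment> \<open>The derivative of \<open>f\<close> at \<open>x\<close> in the radial direction, computed in two ways.\<close>
  have "D x f x = vector_derivative (\<lambda>t. f ((1 + t) *\<^sub>R x)) (at 0)"
    by (simp add: partial_derivative_def scaleR_add_left)
  also have "\<dots> = vector_derivative (\<lambda>t. (1 + t) ^ d *\<^sub>R f x) (at 0)"
    by (simp add: homogD[OF h])
  also have "\<dots> = real d *\<^sub>R f x"
    by (rule vector_derivative_at)
      (auto simp: has_vector_derivative_def intro!: derivative_eq_intros)
  finally have "D x f x = real d *\<^sub>R f x" .
  moreover have "D x f x = (\<Sum>b\<in>Basis. (x \<bullet> b) *\<^sub>R D b f x)"
    using D_sum_direction[OF f, of "\<lambda>b. x \<bullet> b" "\<lambda>b. b" Basis x] by (simp add: euclidean_representation)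
  ultimately show ?thesis by simp
qed

section \<open>Integration by parts on the sphere\<close>

text \<open>
  The surface measure has total mass one, so its integral is a mean value.
\<close>
abbreviation sphere_mean :: "('a::euclidean_space \<Rightarrow> 'b::euclidean_space) \<Rightarrow> 'b" where
  "sphere_mean f \<equiv> LINT x|sphere_measure. f x"

lemma finite_measure_sphere_measure: "finite_measure (sphere_measure :: 'a::euclidean_space measure)"
  by (rule finite_measureI) (simp add: emeasure_sphere_measure_space)

lemma measure_sphere_measure [simp]: "measure sphere_measure (sphere (0::'a::euclidean_space) 1) = 1"
  by (simp add: measure_def emeasure_sphere_measure_space)

lemma borel_measurable_sphere_continuous:
  fixes f :: "'a::euclidean_space \<Rightarrow> 'b::euclidean_space"
  assumes "continuous_on UNIV f"
  shows "f \<in> borel_measurable sphere_measure"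
  unfolding measurable_cong_sets[OF sets_sphere_measure refl]
  by (intro measurable_restrict_space1 borel_measurable_continuous_onI assms)

lemma bounded_on_sphere:
  fixes f :: "'a::euclidean_space \<Rightarrow> 'b::euclidean_space"
  assumes "continuous_on UNIV f"
  shows "\<exists>M. \<forall>x\<in>sphere 0 1. norm (f x) \<le> M"
proof -
  have "compact (f ` sphere 0 1)"
    by (intro compact_continuous_image continuous_on_subset[OF assms]) auto
  then show ?thesis by (auto dest!: compact_imp_bounded simp: bounded_iff)
qed

lemma integrable_sphere_continuous:
  fixes f :: "'a::euclidean_space \<Rightarrow> 'b::euclidean_space"
  assumes "continuous_on UNIV f"
  shows "integrable sphere_measure f"
proof -
  obtain M where "\<forall>x\<in>sphere 0 1. norm (f x) \<le> M" using bounded_on_sphere[OF assms] by blast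
  then show ?thesis
    by (intro finite_measure.integrable_const_bound[OF finite_measure_sphere_measure, where B = M]
        AE_I2 borel_measurable_sphere_continuous assms) auto
qed

lemma integrable_sphere_polynomial:
  fixes f :: "'a::euclidean_space \<Rightarrow> 'b::euclidean_space"
  assumes "polynomial_function f"
  shows "integrable sphere_measure f"
  using assms by (intro integrable_sphere_continuous continuous_on_polymonial_function)

lemma measurable_sphere_orthogonal:
  fixes T :: "'a::euclidean_space \<Rightarrow> 'a"
  assumes T: "orthogonal_transformation T"
  shows "T \<in> sphere_measure \<rightarrow>\<^sub>M sphere_measure"
proof -
  have "T \<in> borel_measurable borel"
    using T by (intro borel_measurable_continuous_onI)
      (simp add: orthogonal_transformation_linear linear_continuous_on linear_conv_bounded_linear[symmetric])
  then show ?thesis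
    unfolding measurable_cong_sets[OF sets_sphere_measure sets_sphere_measure]
    using T by (intro measurable_restrict_space2 measurable_restrict_space1)
     (auto simp: space_restrict_space orthogonal_transformation_norm)
qed

lemma sphere_mean_orthogonal:
  fixes f :: "'a::euclidean_space \<Rightarrow> 'b::euclidean_space" and T :: "'a \<Rightarrow> 'a"
  assumes T: "orthogonal_transformation T" and f: "f \<in> borel_measurable sphere_measure"
  shows "sphere_mean (\<lambda>x. f (T x)) = sphere_mean f"
  using integral_distr[OF measurable_sphere_orthogonal[OF T] f]
  by (simp add: sphere_measure_invariant[OF T])

text \<open>
  The rotation by the angle \<open>\<theta>\<close> in the plane of the axes \<open>a\<close> and \<open>b\<close>, written as a perturbation of the
  identity so that it makes sense in any Euclidean space.
\<close>
definition plane_rotation :: "'a::euclidean_space \<Rightarrow> 'a \<Rightarrow> real \<Rightarrow> 'a \<Rightarrow> 'a" where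
  "plane_rotation a b \<theta> x = x + ((cos \<theta> - 1) * (x \<bullet> a) - sin \<theta> * (x \<bullet> b)) *\<^sub>R a
     + ((cos \<theta> - 1) * (x \<bullet> b) + sin \<theta> * (x \<bullet> a)) *\<^sub>R b"

lemma plane_rotation_inner:
  assumes ab: "a \<in> Basis" "b \<in> Basis" "a \<noteq> b"
  shows "plane_rotation a b \<theta> x \<bullet> a = cos \<theta> * (x \<bullet> a) - sin \<theta> * (x \<bullet> b)"
    and "plane_rotation a b \<theta> x \<bullet> b = cos \<theta> * (x \<bullet> b) + sin \<theta> * (x \<bullet> a)"
  using ab by (simp_all add: plane_rotation_def inner_add_left inner_Basis algebra_simps)

lemma orthogonal_plane_rotation:
  assumes ab: "a \<in> Basis" "b \<in> Basis" "a \<noteq> b"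
  shows "orthogonal_transformation (plane_rotation a b \<theta>)"
  unfolding orthogonal_transformation
proof (intro conjI allI)
  show "linear (plane_rotation a b \<theta>)"
    by (rule linearI) (simp_all add: plane_rotation_def inner_add_left algebra_simps)
  fix x
  let ?c = "cos \<theta>" and ?s = "sin \<theta>" and ?u = "x \<bullet> a" and ?v = "x \<bullet> b"
  have ring: "X + ((c - 1) * u - s * v) * u + ((c - 1) * v + s * u) * v
        + ((c - 1) * u - s * v) * (c * u - s * v) + ((c - 1) * v + s * u) * (c * v + s * u)
      = X + (u\<^sup>2 + v\<^sup>2) * (c\<^sup>2 + s\<^sup>2 - 1)" for X c s u v :: real
    by (simp add: algebra_simps power2_eq_square)
  have "plane_rotation a b \<theta> x \<bullet> plane_rotation a b \<theta> x
      = plane_rotation a b \<theta> x \<bullet> x + ((?c - 1) * ?u - ?s * ?v) * (plane_rotation a b \<theta> x \<bullet> a)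
        + ((?c - 1) * ?v + ?s * ?u) * (plane_rotation a b \<theta> x \<bullet> b)"
    by (subst (2) plane_rotation_def) (simp add: inner_add_right)
  also have "plane_rotation a b \<theta> x \<bullet> x
      = x \<bullet> x + ((?c - 1) * ?u - ?s * ?v) * ?u + ((?c - 1) * ?v + ?s * ?u) * ?v"
    by (simp add: plane_rotation_def inner_add_left inner_commute[of a x] inner_commute[of b x])
  also have "\<dots> + ((?c - 1) * ?u - ?s * ?v) * (plane_rotation a b \<theta> x \<bullet> a)
        + ((?c - 1) * ?v + ?s * ?u) * (plane_rotation a b \<theta> x \<bullet> b)
      = x \<bullet> x + (?u\<^sup>2 + ?v\<^sup>2) * (?c\<^sup>2 + ?s\<^sup>2 - 1)"
    unfolding plane_rotation_inner[OF ab] by (rule ring)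
  also have "\<dots> = x \<bullet> x" by simp
  finally show "norm (plane_rotation a b \<theta> x) = norm x" by (simp add: norm_eq_sqrt_inner)
qed

lemma plane_rotation_0 [simp]: "plane_rotation a b 0 x = x"
  by (simp add: plane_rotation_def)

lemma plane_rotation_derivative:
  assumes ab: "a \<in> Basis" "b \<in> Basis" "a \<noteq> b"
  defines "R \<equiv> plane_rotation a b"
  shows "((\<lambda>\<theta>. R \<theta> x) has_vector_derivative (R \<theta> x \<bullet> a) *\<^sub>R b - (R \<theta> x \<bullet> b) *\<^sub>R a) (at \<theta>)"
  unfolding R_def plane_rotation_inner[OF ab] unfolding plane_rotation_def has_vector_derivative_def
  by (auto intro!: derivative_eq_intros simp: fun_eq_iff algebra_simps)

text \<open>
  The mean of \<open>F\<close> composed with a rotation does not depend on the angle. The derivative of the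
  rotated function with respect to the angle is the function below, evaluated at the rotated point;
  differentiating under the integral sign at angle \<open>0\<close> gives the claim. Dominated convergence applies
  to the difference quotients because the mean value inequality bounds all of them by the maximum of
  the derivative on the sphere.
\<close>
lemma sphere_mean_rotation_generator:
  fixes F :: "'a::euclidean_space \<Rightarrow> 'b::euclidean_space"
  assumes ab: "a \<in> Basis" "b \<in> Basis" and F: "polynomial_function F"
  shows "sphere_mean (\<lambda>x. (x \<bullet> a) *\<^sub>R D b F x - (x \<bullet> b) *\<^sub>R D a F x) = 0"
proof (cases "a = b")
  case True then show ?thesis by simp
next
  case False
  note ab = ab False
  let ?R = "plane_rotation a b"
  let ?L = "\<lambda>x. (x \<bullet> a) *\<^sub>R D b F x - (x \<bullet> b) *\<^sub>R D a F x"
  have L: "polynomial_function ?L"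
    by (intro polynomial_function_diff polynomial_function_mult polynomial_function_coord polynomial_function_D F)
  obtain M where M: "\<forall>x\<in>sphere 0 1. norm (?L x) \<le> M"
    using bounded_on_sphere[OF continuous_on_polymonial_function[OF L]] by blast
  have der: "((\<lambda>\<theta>. F (?R \<theta> x)) has_vector_derivative ?L (?R \<theta> x)) (at \<theta>)" for \<theta> x
  proof -
    let ?y = "?R \<theta> x"
    have "((\<lambda>\<theta>. F (?R \<theta> x)) has_derivative (\<lambda>h. D (h *\<^sub>R ((?y \<bullet> a) *\<^sub>R b - (?y \<bullet> b) *\<^sub>R a)) F ?y)) (at \<theta>)"
      by (rule has_derivative_compose[OF _ polynomial_has_derivative[OF F]])
         (use plane_rotation_derivative[OF ab] in \<open>simp add: has_vector_derivative_def\<close>)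
    moreover have "D (h *\<^sub>R ((?y \<bullet> a) *\<^sub>R b - (?y \<bullet> b) *\<^sub>R a)) F ?y = h *\<^sub>R ?L ?y" for h
      using has_derivative_linear[OF polynomial_has_derivative[OF F, of ?y]]
      by (simp add: linear_scale[where f = "\<lambda>h. D h F ?y"] linear_diff[where f = "\<lambda>h. D h F ?y"])
    ultimately show ?thesis by (simp add: has_vector_derivative_def)
  qed
  define q where "q n x = real (Suc n) *\<^sub>R (F (?R (1 / real (Suc n)) x) - F x)" for n x
  have cF: "continuous_on UNIV F" by (rule continuous_on_polymonial_function[OF F])
  have lin: "linear (?R \<theta>)" for \<theta>
    by (rule orthogonal_transformation_linear[OF orthogonal_plane_rotation[OF ab]])
  have cR: "continuous_on UNIV (\<lambda>x. F (?R \<theta> x))" for \<theta>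
    using continuous_on_compose2[OF cF linear_continuous_on[OF linear_conv_bounded_linear[THEN iffD1, OF lin]]]
    by auto
  have q0: "sphere_mean (q n) = 0" for n
    unfolding q_def
    using sphere_mean_orthogonal[OF orthogonal_plane_rotation[OF ab] borel_measurable_sphere_continuous[OF cF]]
    by (simp add: integrable_sphere_continuous[OF cF] integrable_sphere_continuous[OF cR])
  have lim: "(\<lambda>n. q n x) \<longlonglongrightarrow> ?L x" for x
  proof -
    have "((\<lambda>h. norm (F (?R h x) - F x - h *\<^sub>R ?L x) / norm h) \<longlongrightarrow> 0) (at 0)"
      using der[of x 0] by (simp add: has_vector_derivative_def has_derivative_at)
    also have "(\<lambda>h. norm (F (?R h x) - F x - h *\<^sub>R ?L x) / norm h)
        = (\<lambda>h. norm ((F (?R h x) - F x - h *\<^sub>R ?L x) /\<^sub>R h))"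
      by (simp add: divide_inverse mult.commute)
    finally have "((\<lambda>h. (F (?R h x) - F x - h *\<^sub>R ?L x) /\<^sub>R h) \<longlongrightarrow> 0) (at 0)"
      by (rule tendsto_norm_zero_cancel)
    moreover have "(F (?R h x) - F x - h *\<^sub>R ?L x) /\<^sub>R h = (F (?R h x) - F x) /\<^sub>R h - ?L x"
      if "h \<noteq> 0" for h
      using that by (simp add: scaleR_diff_right[of "inverse h" "F (?R h x) - F x"])
    then have "\<forall>\<^sub>F h in at 0. (F (?R h x) - F x - h *\<^sub>R ?L x) /\<^sub>R h
        = (F (?R h x) - F x) /\<^sub>R h - ?L x"
      unfolding eventually_at_filter by (intro always_eventually) blast
    ultimately have "((\<lambda>h. (F (?R h x) - F x) /\<^sub>R h - ?L x) \<longlongrightarrow> 0) (at 0)"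
      by (rule Lim_transform_eventually)
    then have "((\<lambda>h. (F (?R h x) - F x) /\<^sub>R h) \<longlongrightarrow> ?L x) (at 0)"
      by (rule LIM_zero_cancel)
    then have "(\<lambda>n. (F (?R (1 / real (Suc n)) x) - F x) /\<^sub>R (1 / real (Suc n))) \<longlonglongrightarrow> ?L x"
      by (rule filterlim_compose) (use LIMSEQ_Suc[OF lim_1_over_n[where 'a=real]] in \<open>simp add: filterlim_at\<close>)
    then show ?thesis by (simp add: q_def inverse_eq_divide)
  qed
  have bound: "norm (q n x) \<le> M" if x: "x \<in> sphere 0 1" for n x
  proof -
    have "norm (F (?R (1 / real (Suc n)) x) - F (?R 0 x)) \<le> M * norm (1 / real (Suc n) - 0)"
    proof (rule differentiable_bound[of UNIV])
      fix \<theta> :: real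
      show "((\<lambda>\<theta>. F (?R \<theta> x)) has_derivative (\<lambda>h. h *\<^sub>R ?L (?R \<theta> x))) (at \<theta> within UNIV)"
        using der by (simp add: has_vector_derivative_def)
      have "norm (?L (?R \<theta> x)) \<le> M"
        using x by (intro bspec[OF M]) (simp add: orthogonal_transformation_norm[OF orthogonal_plane_rotation[OF ab]])
      then show "onorm (\<lambda>h. h *\<^sub>R ?L (?R \<theta> x)) \<le> M"
        by (intro onorm_bound) (auto intro: order_trans[OF norm_ge_zero] simp: mult.commute[of M] intro!: mult_left_mono)
    qed auto
    then have "real (Suc n) * norm (F (?R (1 / real (Suc n)) x) - F x) \<le> real (Suc n) * (M * (1 / real (Suc n)))"
      by (intro mult_left_mono) simp_all
    then show ?thesis by (simp only: q_def norm_scaleR abs_of_nat) simp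
  qed
  have "(\<lambda>n. sphere_mean (q n)) \<longlonglongrightarrow> sphere_mean ?L"
  proof (rule integral_dominated_convergence[where w = "\<lambda>x. M"])
    show "?L \<in> borel_measurable sphere_measure"
      by (intro borel_measurable_sphere_continuous continuous_on_polymonial_function L)
    show "q n \<in> borel_measurable sphere_measure" for n
      unfolding q_def by (intro borel_measurable_sphere_continuous continuous_intros cF cR)
    show "integrable sphere_measure (\<lambda>x::'a. M)" by (intro integrable_sphere_continuous continuous_intros)
  qed (use lim bound in auto)
  then show ?thesis by (simp add: q0 LIMSEQ_const_iff)
qed

text \<open>
  Integration by parts on the sphere. Apply the rotation generator in the plane of \<open>b\<close> and \<open>c\<close> to
  the polynomial \<open>(x \<bullet> c) *\<^sub>R F x\<close> and sum over all \<open>c\<close>: Euler's identity and \<open>norm x = 1\<close> reduce the sum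
  to a multiple of \<open>(x \<bullet> b) *\<^sub>R F x\<close> minus the derivative of \<open>F\<close> along \<open>b\<close>.
\<close>
lemma sphere_mean_by_parts:
  fixes F :: "'a::euclidean_space \<Rightarrow> 'b::euclidean_space"
  assumes b: "b \<in> Basis" and F: "polynomial_function F" and h: "homog e F"
  shows "sphere_mean (D b F) = (real e + real DIM('a) - 1) *\<^sub>R sphere_mean (\<lambda>x. (x \<bullet> b) *\<^sub>R F x)"
proof -
  let ?G = "\<lambda>c x. (x \<bullet> b) *\<^sub>R D c (\<lambda>x. (x \<bullet> c) *\<^sub>R F x) x - (x \<bullet> c) *\<^sub>R D b (\<lambda>x. (x \<bullet> c) *\<^sub>R F x) x"
  have pG: "polynomial_function (?G c)" for c
    by (intro polynomial_function_diff polynomial_function_mult polynomial_function_coord polynomial_function_D F)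
  have pb: "polynomial_function (\<lambda>x. (x \<bullet> b) *\<^sub>R F x)"
    by (intro polynomial_function_mult polynomial_function_coord F)
  have sum: "(\<Sum>c\<in>Basis. ?G c x) = (real e + real DIM('a) - 1) *\<^sub>R ((x \<bullet> b) *\<^sub>R F x) - D b F x"
    if x: "x \<in> sphere 0 1" for x
  proof -
    have "(\<Sum>c\<in>Basis. ?G c x)
        = (\<Sum>c\<in>Basis. (x \<bullet> b) *\<^sub>R ((x \<bullet> c) *\<^sub>R D c F x) + (x \<bullet> b) *\<^sub>R F x
            - ((x \<bullet> c) * (x \<bullet> c)) *\<^sub>R D b F x - ((x \<bullet> c) * (b \<bullet> c)) *\<^sub>R F x)"
      by (intro sum.cong refl) (simp add: D_coord_mult[OF F] scaleR_add_right diff_diff_eq)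
    also have "\<dots> = (x \<bullet> b) *\<^sub>R (\<Sum>c\<in>Basis. (x \<bullet> c) *\<^sub>R D c F x) + (real DIM('a) * (x \<bullet> b)) *\<^sub>R F x
        - (\<Sum>c\<in>Basis. (x \<bullet> c) * (x \<bullet> c)) *\<^sub>R D b F x - (\<Sum>c\<in>Basis. (x \<bullet> c) * (b \<bullet> c)) *\<^sub>R F x"
      by (simp add: sum.distrib sum_subtractf scaleR_sum_right scaleR_sum_left sum_constant_scaleR)
    also have "(\<Sum>c\<in>Basis. (x \<bullet> c) * (x \<bullet> c)) = 1"
      using x by (simp add: euclidean_inner[symmetric] norm_eq_1)
    also have "(\<Sum>c\<in>Basis. (x \<bullet> c) * (b \<bullet> c)) = x \<bullet> b"
      by (simp add: euclidean_inner[symmetric])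
    finally show ?thesis
      by (simp add: euler_identity[OF F h] algebra_simps)
  qed
  have "0 = (\<Sum>c\<in>Basis. sphere_mean (?G c))"
    by (simp add: sphere_mean_rotation_generator[OF b _ polynomial_function_mult[OF polynomial_function_coord F]])
  also have "\<dots> = sphere_mean (\<lambda>x. \<Sum>c\<in>Basis. ?G c x)"
    by (rule Bochner_Integration.integral_sum[symmetric]) (rule integrable_sphere_polynomial[OF pG])
  also have "\<dots> = sphere_mean (\<lambda>x. (real e + real DIM('a) - 1) *\<^sub>R ((x \<bullet> b) *\<^sub>R F x) - D b F x)"
    by (rule Bochner_Integration.integral_cong) (use sum in auto)
  also have "\<dots> = (real e + real DIM('a) - 1) *\<^sub>R sphere_mean (\<lambda>x. (x \<bullet> b) *\<^sub>R F x) - sphere_mean (D b F)"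
    using integrable_sphere_polynomial[OF pb] integrable_sphere_polynomial[OF polynomial_function_D[OF F]]
    by (subst Bochner_Integration.integral_diff) (auto simp del: scaleR_scaleR)
  finally show ?thesis by simp
qed

section \<open>Pizzetti's formula\<close>

text \<open>
  Integrate each second derivative by parts and use Euler's identity once more.
\<close>
lemma sphere_mean_laplacian:
  fixes F :: "'a::euclidean_space \<Rightarrow> 'b::euclidean_space"
  assumes F: "polynomial_function F" and h: "homog d F"
  shows "sphere_mean (lap Basis F) = (real d * (real d + real DIM('a) - 2)) *\<^sub>R sphere_mean F"
proof (cases d)
  case 0
  then have "lap Basis F = (\<lambda>x. 0)"
    using D_homog_0[of F] h by (simp add: lap_def[abs_def])
  with 0 show ?thesis by simp
next
  case (Suc e)
  have int: "integrable sphere_measure (D b F)" "integrable sphere_measure (\<lambda>x. (x \<bullet> b) *\<^sub>R D b F x)"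
    "integrable sphere_measure (D b (D b F))" for b
    by (intro integrable_sphere_polynomial polynomial_function_mult polynomial_function_coord polynomial_function_D F)+
  have "sphere_mean (lap Basis F) = (\<Sum>b\<in>Basis. sphere_mean (D b (D b F)))"
    unfolding lap_def by (rule Bochner_Integration.integral_sum) (rule int)
  also have "\<dots> = (\<Sum>b\<in>Basis. (real d + real DIM('a) - 2) *\<^sub>R sphere_mean (\<lambda>x. (x \<bullet> b) *\<^sub>R D b F x))"
    using sphere_mean_by_parts[OF _ polynomial_function_D[OF F] homog_D[OF F h]] Suc
    by (intro sum.cong refl) (simp add: algebra_simps)
  also have "\<dots> = (real d + real DIM('a) - 2) *\<^sub>R sphere_mean (\<lambda>x. \<Sum>b\<in>Basis. (x \<bullet> b) *\<^sub>R D b F x)"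
    by (subst Bochner_Integration.integral_sum) (auto simp: int scaleR_sum_right)
  also have "\<dots> = (real d * (real d + real DIM('a) - 2)) *\<^sub>R sphere_mean F"
    by (simp add: euler_identity[OF F h] mult.commute)
  finally show ?thesis .
qed

lemma sphere_mean_odd:
  fixes F :: "'a::euclidean_space \<Rightarrow> 'b::euclidean_space"
  assumes "F \<in> borel_measurable sphere_measure" and odd: "\<And>x. x \<in> sphere 0 1 \<Longrightarrow> F (- x) = - F x"
  shows "sphere_mean F = 0"
proof -
  have "sphere_mean F = sphere_mean (\<lambda>x. F (- x))"
    by (rule sphere_mean_orthogonal[symmetric]) (use assms in \<open>auto simp: orthogonal_transformation module_hom_uminus\<close>)
  also have "\<dots> = sphere_mean (\<lambda>x. - F x)"
    by (rule Bochner_Integration.integral_cong) (use odd in auto)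
  finally have "sphere_mean F = - sphere_mean F" by simp
  then have "2 *\<^sub>R sphere_mean F = 0" by (simp add: scaleR_2 eq_neg_iff_add_eq_0)
  then show ?thesis by simp
qed

text \<open>
  The factor that relates the mean of a homogeneous polynomial of degree \<open>2 * i\<close> on the unit sphere of
  \<open>\<real>\<^sup>N\<close> to its \<open>i\<close>-fold Laplacian. It is the product of the factors \<open>2 * l * (2 * l + N - 2)\<close> over
  \<open>1 \<le> l \<le> i\<close>.
\<close>
definition pizzetti_const :: "nat \<Rightarrow> nat \<Rightarrow> real" where
  "pizzetti_const N i = 4 ^ i * fact i * pochhammer (real N / 2) i"

lemma pizzetti_const_Suc: "pizzetti_const N (Suc i) = 2 * real (Suc i) * (2 * real (Suc i) + real N - 2) * pizzetti_const N i"
  by (simp add: pizzetti_const_def pochhammer_Suc) (simp add: algebra_simps)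

lemma polynomial_function_lap_power:
  fixes F :: "'a::euclidean_space \<Rightarrow> 'b::euclidean_space"
  shows "polynomial_function F \<Longrightarrow> polynomial_function ((lap B ^^ i) F)"
  by (induction i) (simp_all add: polynomial_function_lap)

lemma homog_lap_power:
  fixes F :: "'a::euclidean_space \<Rightarrow> 'b::euclidean_space"
  assumes "polynomial_function F" "homog d F"
  shows "homog (d - 2 * i) ((lap B ^^ i) F)"
proof (induction i)
  case (Suc i)
  have "homog (d - 2 * i - 2) (lap B ((lap B ^^ i) F))"
    using assms(1) by (intro homog_lap Suc polynomial_function_lap_power)
  then show ?case by simp
qed (simp add: assms)

lemma lap_const [simp]: "lap B (\<lambda>x. c) = (\<lambda>x. 0)"
  by (simp add: lap_def[abs_def])

lemma lap_power_zero [simp]: "(lap B ^^ i) (\<lambda>x. 0) = (\<lambda>x. 0)"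
  by (induction i) simp_all

lemma lap_power_homog_eq_0:
  fixes F :: "'a::euclidean_space \<Rightarrow> 'b::euclidean_space"
  assumes "polynomial_function F" "homog d F" "2 * i > d"
  shows "(lap B ^^ i) F = (\<lambda>x. 0)"
  using assms
proof (induction i arbitrary: d F)
  case (Suc i)
  show ?case
  proof (cases "d \<le> 1")
    case True
    have "lap B F x = 0" for x
      unfolding lap_def using homog_D[OF Suc.prems(1,2)] True D_homog_0[of "D b F" b for b] by simp
    then have "lap B F = (\<lambda>x. 0)" by blast
    then show ?thesis by (simp add: funpow_Suc_right del: funpow.simps)
  next
    case False
    have "(lap B ^^ i) (lap B F) = (\<lambda>x. 0)"
      using Suc.prems False by (intro Suc.IH[of _ "d - 2"] homog_lap) auto
    then show ?thesis by (simp add: funpow_Suc_right del: funpow.simps)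
  qed
qed simp

text \<open>
  Each application of the Laplacian multiplies the mean by a known factor and lowers the degree by two,
  until a constant is left.
\<close>
lemma sphere_mean_homog_even:
  fixes F :: "'a::euclidean_space \<Rightarrow> 'b::euclidean_space"
  assumes "polynomial_function F" "homog (2 * i) F"
  shows "sphere_mean F = (lap Basis ^^ i) F 0 /\<^sub>R pizzetti_const DIM('a) i"
  using assms
proof (induction i arbitrary: F)
  case 0
  then have "F x = F 0" for x by (intro homog_0) simp
  then have "sphere_mean F = sphere_mean (\<lambda>x::'a. F 0)" by metis
  then show ?case by (simp add: pizzetti_const_def)
next
  case (Suc i)
  let ?c = "2 * real (Suc i) * (2 * real (Suc i) + real DIM('a) - 2)"
  have "0 < 2 * real (Suc i) + real DIM('a) - 2"
    using DIM_positive[where 'a='a] by (simp add: add_nonneg_pos)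
  then have "?c \<noteq> 0" by simp
  have "?c *\<^sub>R sphere_mean F = sphere_mean (lap Basis F)"
    using sphere_mean_laplacian[OF Suc.prems] by simp
  also have "\<dots> = (lap Basis ^^ i) (lap Basis F) 0 /\<^sub>R pizzetti_const DIM('a) i"
    using Suc.prems homog_lap[OF Suc.prems] by (intro Suc.IH) auto
  finally have "sphere_mean F = ((lap Basis ^^ i) (lap Basis F) 0 /\<^sub>R pizzetti_const DIM('a) i) /\<^sub>R ?c"
    using \<open>?c \<noteq> 0\<close> by (metis scaleR_left_imp_eq divideR_right)
  then show ?case
    by (simp add: pizzetti_const_Suc funpow_Suc_right mult.commute del: funpow.simps)
qed

text \<open>
  The components of degree above \<open>n\<close> are required to vanish so that decompositions with different
  bounds can be added.
\<close>
lemma polynomial_homog_decomposition: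
  fixes F :: "'a::euclidean_space \<Rightarrow> 'b::euclidean_space"
  assumes "polynomial_function F"
  shows "\<exists>n G. (\<forall>d. polynomial_function (G d) \<and> homog d (G d)) \<and> (\<forall>d>n. G d = (\<lambda>x. 0)) \<and> F = (\<lambda>x. \<Sum>d\<le>n. G d x)"
  using assms
proof (induction rule: polynomial_function_induct)
  case (const c)
  show ?case
    by (intro exI[of _ "0::nat"] exI[of _ "\<lambda>d x. if d = 0 then c else 0"]) (auto simp: homog_def)
next
  case (add f g)
  then obtain n G m H where
    G: "\<forall>d. polynomial_function (G d) \<and> homog d (G d)" "\<forall>d>n. G d = (\<lambda>x. 0)" "f = (\<lambda>x. \<Sum>d\<le>n. G d x)" and
    H: "\<forall>d. polynomial_function (H d) \<and> homog d (H d)" "\<forall>d>m. H d = (\<lambda>x. 0)" "g = (\<lambda>x. \<Sum>d\<le>m. H d x)"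
    by blast
  have "(\<Sum>d\<le>n. G d x) = (\<Sum>d\<le>n + m. G d x)" "(\<Sum>d\<le>m. H d x) = (\<Sum>d\<le>n + m. H d x)" for x
    using G(2) H(2) by (intro sum.mono_neutral_left; auto)+
  then show ?case
    using G H by (intro exI[of _ "n + m"] exI[of _ "\<lambda>d x. G d x + H d x"])
      (auto simp: homog_def sum.distrib scaleR_add_right)
next
  case (scale c f)
  then obtain n G where
    G: "\<forall>d. polynomial_function (G d) \<and> homog d (G d)" "\<forall>d>n. G d = (\<lambda>x. 0)" "f = (\<lambda>x. \<Sum>d\<le>n. G d x)"
    by blast
  then show ?case
    by (intro exI[of _ n] exI[of _ "\<lambda>d x. c *\<^sub>R G d x"]) (auto simp: homog_def scaleR_sum_right)
next
  case (mult u f)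
  then obtain n G where
    G: "\<forall>d. polynomial_function (G d) \<and> homog d (G d)" "\<forall>d>n. G d = (\<lambda>x. 0)" "f = (\<lambda>x. \<Sum>d\<le>n. G d x)"
    by blast
  have "polynomial_function (\<lambda>x. if d = 0 then 0 else (x \<bullet> u) *\<^sub>R G (d - 1) x) \<and>
      homog d (\<lambda>x. if d = 0 then 0 else (x \<bullet> u) *\<^sub>R G (d - 1) x)" for d
    using G(1) polynomial_function_mult[OF polynomial_function_coord, of "G (d - 1)" u]
    by (cases d) (auto simp: homog_def mult.commute mult.left_commute)
  moreover have "(\<Sum>d\<le>Suc n. if d = 0 then 0 else (x \<bullet> u) *\<^sub>R G (d - 1) x) = (x \<bullet> u) *\<^sub>R (\<Sum>d\<le>n. G d x)" for x
    by (subst sum.atMost_Suc_shift) (simp add: scaleR_sum_right)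
  ultimately show ?case
    using G(2,3) by (intro exI[of _ "Suc n"] exI[of _ "\<lambda>d x. if d = 0 then 0 else (x \<bullet> u) *\<^sub>R G (d - 1) x"])
      (auto simp del: sum.atMost_Suc)
qed

lemma lap_power_add:
  fixes f g :: "'a::euclidean_space \<Rightarrow> 'b::euclidean_space"
  assumes "polynomial_function f" "polynomial_function g"
  shows "(lap B ^^ i) (\<lambda>x. f x + g x) = (\<lambda>x. (lap B ^^ i) f x + (lap B ^^ i) g x)"
  using assms by (induction i) (simp_all add: lap_add polynomial_function_lap_power)

text \<open>
  Pizzetti's formula. On the homogeneous component of degree \<open>d\<close> only the term with \<open>2 * i = d\<close>
  survives at the origin, and odd components contribute nothing to either side. The bound \<open>M0\<close> depends on
  the degree of \<open>F\<close>; all terms beyond it vanish.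
\<close>
lemma pizzetti:
  fixes F :: "'a::euclidean_space \<Rightarrow> 'b::euclidean_space"
  assumes F: "polynomial_function F"
  shows "\<exists>M0. \<forall>M\<ge>M0. \<forall>a. sphere_mean (\<lambda>x. F (a *\<^sub>R x)) =
    (\<Sum>i\<le>M. (a ^ (2 * i) / pizzetti_const DIM('a) i) *\<^sub>R (lap Basis ^^ i) F 0)"
proof -
  let ?P = "\<lambda>F::'a \<Rightarrow> 'b. \<lambda>M a. sphere_mean (\<lambda>x. F (a *\<^sub>R x)) =
    (\<Sum>i\<le>M. (a ^ (2 * i) / pizzetti_const DIM('a) i) *\<^sub>R (lap Basis ^^ i) F 0)"
  have hom: "?P G M a" if pG: "polynomial_function G" and hG: "homog d G" and M: "M \<ge> d" for G d M a
  proof -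
    have "sphere_mean (\<lambda>x. G (a *\<^sub>R x)) = a ^ d *\<^sub>R sphere_mean G"
      by (simp add: homogD[OF hG])
    also have "\<dots> = (\<Sum>i\<le>M. (a ^ (2 * i) / pizzetti_const DIM('a) i) *\<^sub>R (lap Basis ^^ i) G 0)"
    proof (cases "even d")
      case True
      then obtain e where e: "d = 2 * e" by blast
      \<comment> \<open>Below \<open>e\<close> a positive degree is left, above \<open>e\<close> the iterated Laplacian is zero.\<close>
      have "(lap Basis ^^ i) G 0 = 0" if "i \<noteq> e" for i
      proof (cases "i < e")
        case True
        then show ?thesis using homog_lap_power[OF pG hG, of i Basis] e by (intro homog_Suc_at_0) auto
      next
        case False
        then show ?thesis using lap_power_homog_eq_0[OF pG hG, of i Basis] that e by simp
      qed
      then have "(\<Sum>i\<le>M. (a ^ (2 * i) / pizzetti_const DIM('a) i) *\<^sub>R (lap Basis ^^ i) G 0)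
          = (\<Sum>i\<in>{e}. (a ^ (2 * i) / pizzetti_const DIM('a) i) *\<^sub>R (lap Basis ^^ i) G 0)"
        using M e by (intro sum.mono_neutral_right) auto
      also have "\<dots> = a ^ d *\<^sub>R sphere_mean G"
        using sphere_mean_homog_even[of G e] pG hG e by (simp add: divide_inverse)
      finally show ?thesis by simp
    next
      case False
      have "(lap Basis ^^ i) G 0 = 0" for i
      proof (cases "2 * i < d")
        case True
        then show ?thesis using homog_lap_power[OF pG hG, of i Basis] by (intro homog_Suc_at_0) auto
      next
        case 2: False
        then have "2 * i > d" using False by (metis dvd_triv_left linorder_neqE_nat)
        then show ?thesis using lap_power_homog_eq_0[OF pG hG, of i Basis] by simp
      qed
      moreover have "sphere_mean G = 0"
        using homogD[OF hG, of "-1"] False pG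
        by (intro sphere_mean_odd borel_measurable_sphere_continuous continuous_on_polymonial_function) auto
      ultimately show ?thesis by simp
    qed
    finally show ?thesis .
  qed
  obtain n G where
    G: "\<And>d. polynomial_function (G d)" "\<And>d. homog d (G d)" "F = (\<lambda>x. \<Sum>d\<le>n. G d x)"
    using polynomial_homog_decomposition[OF F] by blast
  have "?P (\<lambda>x. \<Sum>d\<le>k. G d x) M a" if "k \<le> M" for M a k
    using that
  proof (induction k)
    case 0 then show ?case using hom[OF G(1,2)[of 0]] by simp
  next
    case (Suc k)
    let ?S = "\<lambda>x. \<Sum>d\<le>k. G d x"
    have pS: "polynomial_function ?S" by (intro polynomial_function_sum G) auto
    have int: "integrable sphere_measure (\<lambda>x. H (a *\<^sub>R x))" if "polynomial_function H" for H :: "'a \<Rightarrow> 'b"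
      by (intro integrable_sphere_continuous continuous_on_compose2[OF continuous_on_polymonial_function[OF that, of UNIV]]
         continuous_intros) auto
    have "sphere_mean (\<lambda>x. ?S (a *\<^sub>R x) + G (Suc k) (a *\<^sub>R x))
        = sphere_mean (\<lambda>x. ?S (a *\<^sub>R x)) + sphere_mean (\<lambda>x. G (Suc k) (a *\<^sub>R x))"
      by (intro Bochner_Integration.integral_add int[OF pS] int[OF G(1)])
    also have "\<dots> = (\<Sum>i\<le>M. (a ^ (2 * i) / pizzetti_const DIM('a) i) *\<^sub>R (lap Basis ^^ i) ?S 0) +
       (\<Sum>i\<le>M. (a ^ (2 * i) / pizzetti_const DIM('a) i) *\<^sub>R (lap Basis ^^ i) (G (Suc k)) 0)"
      using Suc hom[OF G(1,2), of "Suc k"] by simp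
    also have "\<dots> = (\<Sum>i\<le>M. (a ^ (2 * i) / pizzetti_const DIM('a) i) *\<^sub>R (lap Basis ^^ i) (\<lambda>x. ?S x + G (Suc k) x) 0)"
      by (simp add: lap_power_add[OF pS G(1)] scaleR_add_right sum.distrib)
    finally show ?case by simp
  qed
  then have "\<forall>M\<ge>n. \<forall>a. ?P F M a" unfolding G(3) by (intro allI impI) assumption
  then show ?thesis ..
qed

section \<open>Harmonic polynomials against weights of the same degree\<close>

lemma homog_mult:
  fixes f :: "'a::euclidean_space \<Rightarrow> 'b::euclidean_space" and g :: "'a \<Rightarrow> real"
  shows "homog e g \<Longrightarrow> homog d f \<Longrightarrow> homog (e + d) (\<lambda>x. g x *\<^sub>R f x)"
  by (simp add: homog_def power_add)

lemma homog_coord: "homog 1 (\<lambda>x::'a::euclidean_space. x \<bullet> b)"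
  by (simp add: homog_def)

lemma lap_scale:
  fixes f :: "'a::euclidean_space \<Rightarrow> 'b::euclidean_space"
  assumes "polynomial_function f"
  shows "lap B (\<lambda>x. c *\<^sub>R f x) = (\<lambda>x. c *\<^sub>R lap B f x)"
  using assms by (simp add: lap_def[abs_def] D_scale polynomial_function_D scaleR_sum_right)

lemma lap_power_scale:
  fixes f :: "'a::euclidean_space \<Rightarrow> 'b::euclidean_space"
  assumes "polynomial_function f"
  shows "(lap B ^^ i) (\<lambda>x. c *\<^sub>R f x) = (\<lambda>x. c *\<^sub>R (lap B ^^ i) f x)"
  using assms by (induction i) (simp_all add: lap_scale polynomial_function_lap_power)

lemma lap_commute:
  fixes f :: "'a::euclidean_space \<Rightarrow> 'b::euclidean_space"
  assumes f: "polynomial_function f"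
  shows "lap A (lap B f) = lap B (lap A f)"
proof
  fix x
  have "D a (D a (D b (D b f))) = D b (D b (D a (D a f)))" for a b
    using f by (metis D_commute polynomial_function_D)
  then have "(\<Sum>a\<in>A. \<Sum>b\<in>B. D b (D b (D a (D a f))) x) = (\<Sum>a\<in>A. \<Sum>b\<in>B. D a (D a (D b (D b f))) x)"
    by simp
  also have "\<dots> = (\<Sum>b\<in>B. \<Sum>a\<in>A. D a (D a (D b (D b f))) x)" by (rule sum.swap)
  finally have *: "(\<Sum>a\<in>A. lap B (D a (D a f)) x) = (\<Sum>b\<in>B. lap A (D b (D b f)) x)"
    by (simp add: lap_def)
  have "D c (D c (lap C f)) = lap C (D c (D c f))" for c C
    using f by (simp add: D_lap polynomial_function_D)
  then have "lap C (lap C' f) x = (\<Sum>c\<in>C. lap C' (D c (D c f)) x)" for C C'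
    by (subst lap_def) simp
  then show "lap A (lap B f) x = lap B (lap A f) x"
    using * by simp
qed

lemma harmonic_lap:
  fixes P :: "'a::euclidean_space \<Rightarrow> 'b::euclidean_space"
  assumes "polynomial_function P" "lap Basis P = (\<lambda>x. 0)"
  shows "lap Basis (lap B P) = (\<lambda>x. 0)"
  using assms by (simp add: lap_commute[of P Basis B])

lemma harmonic_D:
  fixes P :: "'a::euclidean_space \<Rightarrow> 'b::euclidean_space"
  assumes "polynomial_function P" "lap Basis P = (\<lambda>x. 0)"
  shows "lap Basis (D b P) = (\<lambda>x. 0)"
  using D_lap[OF assms(1), of b Basis] assms(2) by simp

text \<open>
  Write \<open>P\<close> by Euler's identity through its first derivatives and integrate the coordinate factors by
  parts. The terms where both derivatives fall on \<open>P\<close> add up to its Laplacian and disappear.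
\<close>
lemma harmonic_pairing:
  fixes P :: "'a::euclidean_space \<Rightarrow> 'b::euclidean_space" and g :: "'a \<Rightarrow> real"
  assumes P: "polynomial_function P" "homog (Suc d) P" "lap Basis P = (\<lambda>x. 0)"
    and g: "polynomial_function g" "homog e g"
  shows "(real (Suc d) * (real d + real e + real DIM('a) - 1)) *\<^sub>R sphere_mean (\<lambda>x. g x *\<^sub>R P x)
      = (\<Sum>b\<in>Basis. sphere_mean (\<lambda>x. D b g x *\<^sub>R D b P x))"
proof -
  let ?c = "real d + real e + real DIM('a) - 1"
  have int: "integrable sphere_measure (\<lambda>x. (x \<bullet> b) *\<^sub>R (g x *\<^sub>R D b P x))"
    "integrable sphere_measure (\<lambda>x. g x *\<^sub>R D b (D b P) x)"
    "integrable sphere_measure (\<lambda>x. D b g x *\<^sub>R D b P x)" for b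
    by (rule integrable_sphere_polynomial polynomial_function_mult polynomial_function_coord polynomial_function_D P g)+
  have part: "?c *\<^sub>R sphere_mean (\<lambda>x. (x \<bullet> b) *\<^sub>R (g x *\<^sub>R D b P x))
      = sphere_mean (\<lambda>x. g x *\<^sub>R D b (D b P) x) + sphere_mean (\<lambda>x. D b g x *\<^sub>R D b P x)"
    if b: "b \<in> Basis" for b
  proof -
    have h: "homog (e + d) (\<lambda>x. g x *\<^sub>R D b P x)"
      using homog_mult[OF g(2) homog_D[OF P(1,2)]] by simp
    have p: "polynomial_function (\<lambda>x. g x *\<^sub>R D b P x)"
      by (intro polynomial_function_mult polynomial_function_D P g)
    have "?c *\<^sub>R sphere_mean (\<lambda>x. (x \<bullet> b) *\<^sub>R (g x *\<^sub>R D b P x)) = sphere_mean (D b (\<lambda>x. g x *\<^sub>R D b P x))"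
      using sphere_mean_by_parts[OF b p h] by (simp add: add.commute)
    also have "\<dots> = sphere_mean (\<lambda>x. g x *\<^sub>R D b (D b P) x + D b g x *\<^sub>R D b P x)"
      by (subst D_mult) (auto simp: g P polynomial_function_D)
    also have "\<dots> = sphere_mean (\<lambda>x. g x *\<^sub>R D b (D b P) x) + sphere_mean (\<lambda>x. D b g x *\<^sub>R D b P x)"
      by (intro Bochner_Integration.integral_add int)
    finally show ?thesis .
  qed
  have "(real (Suc d) * ?c) *\<^sub>R sphere_mean (\<lambda>x. g x *\<^sub>R P x)
      = ?c *\<^sub>R sphere_mean (\<lambda>x. g x *\<^sub>R (real (Suc d) *\<^sub>R P x))"
    unfolding scaleR_left_commute[of "g _"]
    by (subst integral_scaleR_right) (simp_all add: mult.commute del: of_nat_Suc)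
  also have "\<dots> = ?c *\<^sub>R sphere_mean (\<lambda>x. \<Sum>b\<in>Basis. (x \<bullet> b) *\<^sub>R (g x *\<^sub>R D b P x))"
    by (simp only: euler_identity[OF P(1,2), symmetric] scaleR_sum_right scaleR_left_commute)
  also have "\<dots> = (\<Sum>b\<in>Basis. ?c *\<^sub>R sphere_mean (\<lambda>x. (x \<bullet> b) *\<^sub>R (g x *\<^sub>R D b P x)))"
    by (subst Bochner_Integration.integral_sum[OF int(1)]) (rule scaleR_sum_right)
  also have "\<dots> = (\<Sum>b\<in>Basis. sphere_mean (\<lambda>x. g x *\<^sub>R D b (D b P) x))
      + (\<Sum>b\<in>Basis. sphere_mean (\<lambda>x. D b g x *\<^sub>R D b P x))"
    by (simp only: part sum.distrib cong: sum.cong)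
  also have "(\<Sum>b\<in>Basis. sphere_mean (\<lambda>x. g x *\<^sub>R D b (D b P) x))
      = sphere_mean (\<lambda>x. g x *\<^sub>R lap Basis P x)"
    by (subst Bochner_Integration.integral_sum[OF int(2), symmetric]) (simp add: lap_def scaleR_sum_right)
  finally show ?thesis by (simp add: P(3))
qed

text \<open>
  The pairing identity lowers both degrees by one and keeps the derivatives of \<open>P\<close> harmonic, so that
  eventually a constant \<open>g\<close> is differentiated. The dimension bound keeps the factor in the pairing
  identity positive: it vanishes for a linear \<open>P\<close> and a constant \<open>g\<close> on the real line.
\<close>
lemma harmonic_orthogonal_lower_degree:
  fixes P :: "'a::euclidean_space \<Rightarrow> 'b::euclidean_space" and g :: "'a \<Rightarrow> real"
  assumes dim: "DIM('a) \<ge> 2"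
    and "polynomial_function P" "homog d P" "lap Basis P = (\<lambda>x. 0)"
    and "polynomial_function g" "homog e g" "e < d"
  shows "sphere_mean (\<lambda>x. g x *\<^sub>R P x) = 0"
  using assms(2-)
proof (induction d arbitrary: e g P)
  case (Suc d)
  have "sphere_mean (\<lambda>x. D b g x *\<^sub>R D b P x) = 0" for b
  proof (cases e)
    case 0
    then show ?thesis using D_homog_0[of g b] Suc.prems by simp
  next
    case (Suc e')
    show ?thesis
    proof (rule Suc.IH[of _ _ e'])
      show "homog d (D b P)" using homog_D[OF Suc.prems(1,2)] by simp
      show "homog e' (D b g)" using homog_D[OF Suc.prems(4,5)] Suc by simp
    qed (use Suc Suc.prems in \<open>auto intro: harmonic_D polynomial_function_D\<close>)
  qed
  then have "(real (Suc d) * (real d + real e + real DIM('a) - 1)) *\<^sub>R sphere_mean (\<lambda>x. g x *\<^sub>R P x) = 0"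
    using harmonic_pairing[OF Suc.prems(1-5)] by simp
  moreover have "real d + real e + real DIM('a) - 1 > 0" using dim by linarith
  ultimately show ?case by auto
qed simp

text \<open>
  Against a harmonic polynomial, multiplication by a coordinate is up to a constant the transpose of
  differentiation. In the integration by parts the derivative may also fall on \<open>g\<close>, but this term has
  too low a degree to be seen by \<open>P\<close>.
\<close>
lemma harmonic_coord_transpose:
  fixes P :: "'a::euclidean_space \<Rightarrow> 'b::euclidean_space" and g :: "'a \<Rightarrow> real"
  assumes dim: "DIM('a) \<ge> 2" and b: "b \<in> Basis"
    and P: "polynomial_function P" "homog (Suc d) P" "lap Basis P = (\<lambda>x. 0)"
    and g: "polynomial_function g" "homog d g"
  shows "sphere_mean (\<lambda>x. ((x \<bullet> b) * g x) *\<^sub>R P x) = sphere_mean (\<lambda>x. g x *\<^sub>R D b P x) /\<^sub>R (real DIM('a) + 2 * real d)"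
proof -
  have int: "integrable sphere_measure (\<lambda>x. g x *\<^sub>R D b P x)" "integrable sphere_measure (\<lambda>x. D b g x *\<^sub>R P x)"
    by (rule integrable_sphere_polynomial polynomial_function_mult polynomial_function_D P g)+
  have h: "homog (d + Suc d) (\<lambda>x. g x *\<^sub>R P x)" by (rule homog_mult[OF g(2) P(2)])
  have p: "polynomial_function (\<lambda>x. g x *\<^sub>R P x)" by (intro polynomial_function_mult P g)
  have "(real DIM('a) + 2 * real d) *\<^sub>R sphere_mean (\<lambda>x. ((x \<bullet> b) * g x) *\<^sub>R P x) = sphere_mean (D b (\<lambda>x. g x *\<^sub>R P x))"
    using sphere_mean_by_parts[OF b p h] by (simp add: algebra_simps)
  also have "\<dots> = sphere_mean (\<lambda>x. g x *\<^sub>R D b P x + D b g x *\<^sub>R P x)"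
    by (subst D_mult) (auto simp: g P)
  also have "\<dots> = sphere_mean (\<lambda>x. g x *\<^sub>R D b P x) + sphere_mean (\<lambda>x. D b g x *\<^sub>R P x)"
    by (intro Bochner_Integration.integral_add int)
  also have "sphere_mean (\<lambda>x. D b g x *\<^sub>R P x) = 0"
    by (rule harmonic_orthogonal_lower_degree[OF dim P _ homog_D[OF g]]) (auto simp: g polynomial_function_D)
  finally have "(real DIM('a) + 2 * real d) *\<^sub>R sphere_mean (\<lambda>x. ((x \<bullet> b) * g x) *\<^sub>R P x)
    = sphere_mean (\<lambda>x. g x *\<^sub>R D b P x)" by simp
  moreover have "real DIM('a) + 2 * real d \<noteq> 0" using dim by linarith
  ultimately show ?thesis by (metis divideR_right)
qed

definition norm_sq_on :: "'a set \<Rightarrow> 'a::euclidean_space \<Rightarrow> real" where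
  "norm_sq_on B x = (\<Sum>b\<in>B. (x \<bullet> b)\<^sup>2)"

lemma polynomial_function_norm_sq_on: "finite B \<Longrightarrow> polynomial_function (norm_sq_on B)"
  unfolding norm_sq_on_def[abs_def] power2_eq_square
  using polynomial_function_mult[OF polynomial_function_coord polynomial_function_coord]
  by (intro polynomial_function_sum) auto

lemma polynomial_function_norm_sq_monomial:
  assumes "finite A" "finite B"
  shows "polynomial_function (\<lambda>x. norm_sq_on A x ^ s * norm_sq_on B x ^ t)"
proof -
  have pow: "polynomial_function (\<lambda>x. norm_sq_on C x ^ i)" if "finite C" for C :: "'a set" and i
    using polynomial_function_norm_sq_on[OF that] by (auto simp: real_polynomial_function_eq[symmetric])
  show ?thesis using polynomial_function_mult[OF pow pow] assms by simp
qed

lemma homog_norm_sq_on: "homog 2 (norm_sq_on B)"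
  by (simp add: homog_def norm_sq_on_def power_mult_distrib sum_distrib_left)

lemma harmonic_norm_sq_transpose:
  fixes P :: "'a::euclidean_space \<Rightarrow> 'b::euclidean_space" and g :: "'a \<Rightarrow> real"
  assumes dim: "DIM('a) \<ge> 2" and B: "B \<subseteq> Basis"
    and P: "polynomial_function P" "homog (d + 2) P" "lap Basis P = (\<lambda>x. 0)"
    and g: "polynomial_function g" "homog d g"
  shows "sphere_mean (\<lambda>x. (norm_sq_on B x * g x) *\<^sub>R P x) =
    sphere_mean (\<lambda>x. g x *\<^sub>R lap B P x) /\<^sub>R ((real DIM('a) + 2 * real d) * (real DIM('a) + 2 * real (Suc d)))"
proof -
  let ?k = "(real DIM('a) + 2 * real d) * (real DIM('a) + 2 * real (Suc d))"
  have pc: "polynomial_function (\<lambda>x. (x \<bullet> b) * g x)" and hc: "homog (Suc d) (\<lambda>x. (x \<bullet> b) * g x)" for b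
    using polynomial_function_mult[OF polynomial_function_coord g(1)] homog_mult[OF homog_coord g(2)] by simp_all
  have int1: "integrable sphere_measure (\<lambda>x. ((x \<bullet> b) * ((x \<bullet> b) * g x)) *\<^sub>R P x)" for b
    using polynomial_function_mult[OF polynomial_function_mult[OF polynomial_function_coord pc] P(1), of b b]
    by (intro integrable_sphere_polynomial) simp
  have int2: "integrable sphere_measure (\<lambda>x. g x *\<^sub>R D b (D b P) x)" for b
    by (rule integrable_sphere_polynomial polynomial_function_mult polynomial_function_D P g)+
  have step: "sphere_mean (\<lambda>x. ((x \<bullet> b) * ((x \<bullet> b) * g x)) *\<^sub>R P x) = sphere_mean (\<lambda>x. g x *\<^sub>R D b (D b P) x) /\<^sub>R ?k"
    if "b \<in> B" for b
  proof -
    have b: "b \<in> Basis" using that B by blast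
    have P2: "homog (Suc (Suc d)) P" using P(2) by simp
    have "homog (Suc d) (D b P)" using homog_D[OF P(1,2)] by simp
    from harmonic_coord_transpose[OF dim b P(1) P2 P(3) pc hc]
      harmonic_coord_transpose[OF dim b polynomial_function_D[OF P(1)] this harmonic_D[OF P(1,3)] g]
    show ?thesis by (simp add: mult.commute del: of_nat_Suc)
  qed
  have "sphere_mean (\<lambda>x. (norm_sq_on B x * g x) *\<^sub>R P x)
      = sphere_mean (\<lambda>x. \<Sum>b\<in>B. ((x \<bullet> b) * ((x \<bullet> b) * g x)) *\<^sub>R P x)"
    by (simp add: norm_sq_on_def power2_eq_square sum_distrib_right scaleR_sum_left mult.assoc)
  also have "\<dots> = (\<Sum>b\<in>B. sphere_mean (\<lambda>x. g x *\<^sub>R D b (D b P) x) /\<^sub>R ?k)"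
    by (subst Bochner_Integration.integral_sum[OF int1]) (intro sum.cong refl step)
  also have "\<dots> = sphere_mean (\<lambda>x. g x *\<^sub>R lap B P x) /\<^sub>R ?k"
    unfolding scaleR_sum_right[symmetric]
    by (subst Bochner_Integration.integral_sum[OF int2, symmetric]) (simp add: lap_def scaleR_sum_right)
  finally show ?thesis .
qed

text \<open>
  The product of the factors \<open>N + 2 * l\<close> over \<open>0 \<le> l < 2 * m\<close>, one for each of the \<open>2 * m\<close> coordinates that
  are moved from the weight to the harmonic polynomial. It is the ratio of the Fischer product to the inner
  product on the sphere for harmonic polynomials of degree \<open>2 * m\<close>.
\<close>
definition fischer_const :: "nat \<Rightarrow> nat \<Rightarrow> real" where
  "fischer_const N m = 4 ^ m * pochhammer (real N / 2) (2 * m)"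

lemma fischer_const_Suc:
  "fischer_const N (Suc m) = (real N + 2 * real (2 * m)) * (real N + 2 * real (Suc (2 * m))) * fischer_const N m"
  by (simp add: fischer_const_def pochhammer_Suc) (simp add: algebra_simps)

text \<open>
  Every squared coordinate in the weight is exchanged for a second derivative of \<open>P\<close>; after \<open>s + t\<close>
  exchanges \<open>P\<close> has become a constant.
\<close>
lemma harmonic_bihomogeneous_mean:
  fixes P :: "'a::euclidean_space \<Rightarrow> 'b::euclidean_space"
  assumes dim: "DIM('a) \<ge> 2" and A: "A \<subseteq> Basis" and B: "B \<subseteq> Basis"
    and P: "polynomial_function P" "homog (2 * (s + t)) P" "lap Basis P = (\<lambda>x. 0)"
  shows "sphere_mean (\<lambda>x. (norm_sq_on A x ^ s * norm_sq_on B x ^ t) *\<^sub>R P x)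
    = (lap B ^^ t) ((lap A ^^ s) P) 0 /\<^sub>R fischer_const DIM('a) (s + t)"
proof -
  have fin: "finite A" "finite B" using A B by (auto intro: finite_subset[OF _ finite_Basis])
  note pg = polynomial_function_norm_sq_monomial[OF fin]
  have hg: "homog (2 * (i + j)) (\<lambda>x. norm_sq_on A x ^ i * norm_sq_on B x ^ j)" for i j
    using homogD[OF homog_norm_sq_on[of A]] homogD[OF homog_norm_sq_on[of B]]
    by (auto simp: homog_def power_mult_distrib power_mult[symmetric] power_add[symmetric] algebra_simps)
  have step: "sphere_mean (\<lambda>x. (norm_sq_on C x * g x) *\<^sub>R P x) =
      sphere_mean (\<lambda>x. g x *\<^sub>R lap C P x) /\<^sub>R ((real DIM('a) + 2 * real (2 * m)) * (real DIM('a) + 2 * real (Suc (2 * m))))"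
    if "C \<subseteq> Basis" "polynomial_function P" "homog (2 * Suc m) P" "lap Basis P = (\<lambda>x. 0)"
      "polynomial_function g" "homog (2 * m) g"
    for C g m and P :: "'a \<Rightarrow> 'b"
    using that by (intro harmonic_norm_sq_transpose[OF dim]) auto
  have lapP: "polynomial_function (lap C P) \<and> homog (2 * m) (lap C P) \<and> lap Basis (lap C P) = (\<lambda>x. 0)"
    if "polynomial_function P" "homog (2 * Suc m) P" "lap Basis P = (\<lambda>x. 0)" for C m and P :: "'a \<Rightarrow> 'b"
    using that homog_lap[OF that(1,2), of C] harmonic_lap[OF that(1,3), of C] by (auto intro: polynomial_function_lap)
  have base: "sphere_mean (\<lambda>x. norm_sq_on B x ^ t *\<^sub>R P x) = (lap B ^^ t) P 0 /\<^sub>R fischer_const DIM('a) t"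
    if "polynomial_function P" "homog (2 * t) P" "lap Basis P = (\<lambda>x. 0)" for P :: "'a \<Rightarrow> 'b" and t
    using that
  proof (induction t arbitrary: P)
    case 0
    then have "P x = P 0" for x by (intro homog_0) simp
    then have "sphere_mean P = sphere_mean (\<lambda>x::'a. P 0)" by metis
    then show ?case by (simp add: fischer_const_def)
  next
    case (Suc t)
    have "sphere_mean (\<lambda>x. (norm_sq_on B x * norm_sq_on B x ^ t) *\<^sub>R P x) =
        sphere_mean (\<lambda>x. norm_sq_on B x ^ t *\<^sub>R lap B P x) /\<^sub>R
          ((real DIM('a) + 2 * real (2 * t)) * (real DIM('a) + 2 * real (Suc (2 * t))))"
      using pg[of 0 t] hg[of 0 t] by (intro step B Suc.prems) simp_all
    also have "sphere_mean (\<lambda>x. norm_sq_on B x ^ t *\<^sub>R lap B P x) = (lap B ^^ t) (lap B P) 0 /\<^sub>R fischer_const DIM('a) t"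
      using lapP[OF Suc.prems, of B] by (intro Suc.IH) auto
    finally show ?case
      by (simp add: fischer_const_Suc funpow_Suc_right mult.commute del: funpow.simps of_nat_Suc)
  qed
  show ?thesis
    using P
  proof (induction s arbitrary: P)
    case 0
    then show ?case using base[of P t] by simp
  next
    case (Suc s)
    have hP: "homog (2 * Suc (s + t)) P" using Suc.prems by simp
    have "sphere_mean (\<lambda>x. (norm_sq_on A x * (norm_sq_on A x ^ s * norm_sq_on B x ^ t)) *\<^sub>R P x) =
        sphere_mean (\<lambda>x. (norm_sq_on A x ^ s * norm_sq_on B x ^ t) *\<^sub>R lap A P x) /\<^sub>R
          ((real DIM('a) + 2 * real (2 * (s + t))) * (real DIM('a) + 2 * real (Suc (2 * (s + t)))))"
      by (intro step A Suc.prems hP pg hg)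
    also have "sphere_mean (\<lambda>x. (norm_sq_on A x ^ s * norm_sq_on B x ^ t) *\<^sub>R lap A P x)
        = (lap B ^^ t) ((lap A ^^ s) (lap A P)) 0 /\<^sub>R fischer_const DIM('a) (s + t)"
      using lapP[OF Suc.prems(1) hP Suc.prems(3), of A] by (intro Suc.IH) auto
    finally show ?case
      by (simp add: fischer_const_Suc funpow_Suc_right mult.commute mult.left_commute del: funpow.simps of_nat_Suc)
  qed
qed

text \<open>
  The two partial Laplacians of a harmonic polynomial are negatives of each other, and applying
  one of them gives a harmonic polynomial again, so the argument can be repeated.
\<close>
lemma harmonic_lap_power_complement:
  fixes P :: "'a::euclidean_space \<Rightarrow> 'b::euclidean_space"
  assumes P: "polynomial_function P" "lap Basis P = (\<lambda>x. 0)"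
    and AB: "A \<union> B = Basis" "A \<inter> B = {}"
  shows "(lap A ^^ i) P = (\<lambda>x. (- 1) ^ i *\<^sub>R (lap B ^^ i) P x)"
proof (induction i)
  case (Suc i)
  have fin: "finite A" "finite B" using AB finite_Un[of A B] finite_Basis by metis+
  let ?Q = "(lap B ^^ i) P"
  have Q: "polynomial_function ?Q" by (intro polynomial_function_lap_power P)
  have "lap Basis ?Q = (\<lambda>x. 0)"
    by (induction i) (simp_all add: P harmonic_lap polynomial_function_lap_power)
  then have "lap A ?Q x + lap B ?Q x = 0" for x
    using AB fin sum.union_disjoint[of A B "\<lambda>b. D b (D b ?Q) x"] by (simp add: lap_def fun_eq_iff)
  then have "lap A ?Q = (\<lambda>x. - lap B ?Q x)" by (simp add: fun_eq_iff eq_neg_iff_add_eq_0)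
  then show ?case
    by (simp add: Suc lap_scale[OF Q])
qed simp

lemma lap_power_mixed:
  fixes P :: "'a::euclidean_space \<Rightarrow> 'b::euclidean_space"
  assumes P: "polynomial_function P" "lap Basis P = (\<lambda>x. 0)"
    and AB: "A \<union> B = Basis" "A \<inter> B = {}" and i: "i \<le> m"
  shows "(lap B ^^ (m - i)) ((lap A ^^ i) P) x = (- 1) ^ i *\<^sub>R (lap B ^^ m) P x"
proof -
  have "(lap B ^^ (m - i)) ((lap A ^^ i) P) = (lap B ^^ (m - i)) (\<lambda>x. (- 1) ^ i *\<^sub>R (lap B ^^ i) P x)"
    by (simp only: harmonic_lap_power_complement[OF P AB])
  also have "\<dots> = (\<lambda>x. (- 1) ^ i *\<^sub>R (lap B ^^ (m - i)) ((lap B ^^ i) P) x)"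
    by (intro lap_power_scale polynomial_function_lap_power P)
  also have "(lap B ^^ (m - i)) ((lap B ^^ i) P) = (lap B ^^ m) P"
    using i by (simp add: funpow_add[symmetric, THEN fun_cong, unfolded o_def])
  finally show ?thesis by simp
qed

section \<open>Bispherical means of harmonic polynomials\<close>

lemma lap_power_affine:
  assumes "linear L" "inj_on L B"
  shows "(lap B ^^ i) (\<lambda>x. f (a + L x)) = (\<lambda>x. (lap (L ` B) ^^ i) f (a + L x))"
  by (induction i) (simp_all add: lap_affine[OF assms])

definition fst_axes :: "(real ^ ('p::finite + 'q::finite)) set" where
  "fst_axes = (\<lambda>x. vec_join x 0) ` Basis"

definition snd_axes :: "(real ^ ('p::finite + 'q::finite)) set" where
  "snd_axes = (\<lambda>y. vec_join 0 y) ` Basis"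

lemma linear_vec_join:
  "linear (\<lambda>x. vec_join x 0 :: real ^ ('p::finite + 'q::finite))"
  "linear (\<lambda>y. vec_join 0 y :: real ^ ('p::finite + 'q::finite))"
  using vec_join_add[of _ _ 0 0] vec_join_scaleR[of _ _ 0] vec_join_add[of 0 0] vec_join_scaleR[of _ 0]
  by (auto intro!: linearI)

lemma inj_on_vec_join:
  "inj_on (\<lambda>x. vec_join x 0 :: real ^ ('p::finite + 'q::finite)) S"
  "inj_on (\<lambda>y. vec_join 0 y :: real ^ ('p::finite + 'q::finite)) T"
  by (auto simp: inj_on_def)

lemma vec_join_0 [simp]: "vec_join 0 0 = 0"
  by (simp add: vec_join_def vec_eq_iff split: sum.split)

lemma vec_join_split: "vec_join x y = vec_join 0 y + vec_join x 0"
  using vec_join_add[of 0 x y 0] by simp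

lemma axes_partition:
  "fst_axes \<union> snd_axes = (Basis :: (real ^ ('p::finite + 'q::finite)) set)"
  "fst_axes \<inter> snd_axes = ({} :: (real ^ ('p::finite + 'q::finite)) set)"
proof -
  have l: "vec_join (axis i 1) 0 = (axis (Inl i) 1 :: real ^ ('p::finite + 'q::finite))" for i
    by (auto simp: vec_eq_iff vec_join_def axis_def split: sum.split)
  have r: "vec_join 0 (axis i 1) = (axis (Inr i) 1 :: real ^ ('p::finite + 'q::finite))" for i
    by (auto simp: vec_eq_iff vec_join_def axis_def split: sum.split)
  have "fst_axes = range (\<lambda>i. axis (Inl i) 1 :: real ^ ('p::finite + 'q::finite))"
    "snd_axes = range (\<lambda>i. axis (Inr i) 1 :: real ^ ('p::finite + 'q::finite))"
    by (auto simp: fst_axes_def snd_axes_def Basis_vec_def image_image l r UNION_singleton_eq_range)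
  then show "fst_axes \<union> snd_axes = (Basis :: (real ^ ('p::finite + 'q::finite)) set)"
    by (auto simp: Basis_vec_def axis_eq_axis UNIV_sum)
  show "fst_axes \<inter> snd_axes = ({} :: (real ^ ('p::finite + 'q::finite)) set)"
    by (auto simp: fst_axes_def snd_axes_def)
qed

lemma norm_sq_on_axes:
  fixes x :: "real ^ 'p::finite" and y :: "real ^ 'q::finite"
  shows "norm_sq_on fst_axes (vec_join x y) = (norm x)\<^sup>2"
    "norm_sq_on snd_axes (vec_join x y) = (norm y)\<^sup>2"
proof -
  have norm: "(norm z)\<^sup>2 = (\<Sum>b\<in>Basis. (z \<bullet> b)\<^sup>2)" for z :: "real ^ 'r::finite"
    unfolding power2_norm_eq_inner by (subst euclidean_inner) (simp add: power2_eq_square)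
  show "norm_sq_on fst_axes (vec_join x y) = (norm x)\<^sup>2" "norm_sq_on snd_axes (vec_join x y) = (norm y)\<^sup>2"
    by (simp_all add: norm_sq_on_def fst_axes_def snd_axes_def sum.reindex inj_on_vec_join inner_vec_join norm)
qed

lemma polynomial_function_affine:
  fixes F :: "'b::euclidean_space \<Rightarrow> 'c::euclidean_space" and L :: "'a::euclidean_space \<Rightarrow> 'b"
  assumes "polynomial_function F" "linear L"
  shows "polynomial_function (\<lambda>x. F (c + L x))"
proof -
  have "polynomial_function (\<lambda>x. c + L x)"
    using assms(2) by (intro polynomial_function_add polynomial_function_const polynomial_function_bounded_linear)
      (simp add: linear_conv_bounded_linear)
  from polynomial_function_compose[OF this assms(1)] show ?thesis by (simp add: o_def)
qed

lemma polynomial_function_vec_join_0: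
  fixes F :: "real ^ ('p::finite + 'q::finite) \<Rightarrow> 'b::euclidean_space"
  assumes "polynomial_function F"
  shows "polynomial_function (\<lambda>y. F (vec_join 0 y))"
  using polynomial_function_affine[OF assms linear_vec_join(2), of 0] by simp

lemma homog_vec_join_0:
  fixes F :: "real ^ ('p::finite + 'q::finite) \<Rightarrow> 'b::euclidean_space"
  assumes "homog d F"
  shows "homog d (\<lambda>y. F (vec_join 0 y))"
  using homogD[OF assms] by (simp add: homog_def linear_scale[OF linear_vec_join(2)])

text \<open>
  Pizzetti's formula in the first block of coordinates, with the second block as a parameter. In terms
  of the whole space the degree of \<open>P\<close> cuts off the sum at a place that does not depend on \<open>y\<close>.
\<close>
lemma first_block_mean:
  fixes P :: "real ^ ('p::finite + 'q::finite) \<Rightarrow> 'b::euclidean_space"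
  assumes P: "polynomial_function P" "homog d P"
  shows "(LINT \<eta>|sphere_measure. P (vec_join (a *\<^sub>R \<eta>) y))
    = (\<Sum>i\<le>d div 2. (a ^ (2 * i) / pizzetti_const CARD('p) i) *\<^sub>R (lap fst_axes ^^ i) P (vec_join 0 y))"
proof -
  let ?p = "pizzetti_const CARD('p)" and ?A = "fst_axes :: (real ^ ('p + 'q)) set"
  let ?F = "\<lambda>x. P (vec_join 0 y + vec_join x 0)"
  have pF: "polynomial_function ?F" by (rule polynomial_function_affine[OF P(1) linear_vec_join(1)])
  obtain M0 where M0: "\<forall>M\<ge>M0. \<forall>a. sphere_mean (\<lambda>x. ?F (a *\<^sub>R x))
      = (\<Sum>i\<le>M. (a ^ (2 * i) / ?p i) *\<^sub>R (lap Basis ^^ i) ?F 0)"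
    using pizzetti[OF pF] by auto
  have lapF: "(lap Basis ^^ i) ?F 0 = (lap ?A ^^ i) P (vec_join 0 y)" for i
    by (subst lap_power_affine[OF linear_vec_join(1) inj_on_vec_join(1)]) (simp add: fst_axes_def)
  have "(LINT \<eta>|sphere_measure. P (vec_join (a *\<^sub>R \<eta>) y))
      = (\<Sum>i\<le>max (d div 2) M0. (a ^ (2 * i) / ?p i) *\<^sub>R (lap ?A ^^ i) P (vec_join 0 y))"
    using M0[rule_format, of "max (d div 2) M0" a] unfolding lapF by (simp add: vec_join_split[symmetric])
  also have "\<dots> = (\<Sum>i\<le>d div 2. (a ^ (2 * i) / ?p i) *\<^sub>R (lap ?A ^^ i) P (vec_join 0 y))"
  proof (rule sum.mono_neutral_right)
    have "(lap ?A ^^ i) P = (\<lambda>x. 0)" if "i > d div 2" for i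
      using that by (intro lap_power_homog_eq_0[OF P]) simp
    then show "\<forall>i\<in>{..max (d div 2) M0} - {..d div 2}. (a ^ (2 * i) / ?p i) *\<^sub>R (lap ?A ^^ i) P (vec_join 0 y) = 0"
      by auto
  qed auto
  finally show ?thesis .
qed

lemma bispherical_mean_odd:
  fixes P :: "real ^ ('p::finite + 'q::finite) \<Rightarrow> 'b::euclidean_space"
  assumes P: "polynomial_function P" "homog d P" and "odd d"
  shows "(LINT \<zeta>|sphere_measure. LINT \<eta>|sphere_measure. P (vec_join (a *\<^sub>R \<eta>) (b *\<^sub>R \<zeta>))) = 0"
  unfolding first_block_mean[OF P]
proof (rule sphere_mean_odd)
  let ?G = "\<lambda>i y. (lap (fst_axes :: (real ^ ('p + 'q)) set) ^^ i) P (vec_join 0 y)"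
  have pG: "polynomial_function (?G i)" for i
    by (intro polynomial_function_vec_join_0 polynomial_function_lap_power P)
  have hG: "homog (d - 2 * i) (?G i)" for i
    by (intro homog_vec_join_0 homog_lap_power P)
  show "(\<lambda>\<zeta>. \<Sum>i\<le>d div 2. (a ^ (2 * i) / pizzetti_const CARD('p) i) *\<^sub>R ?G i (b *\<^sub>R \<zeta>)) \<in> borel_measurable sphere_measure"
    unfolding homogD[OF hG]
    by (intro borel_measurable_sphere_continuous continuous_on_polymonial_function polynomial_function_sum
        polynomial_function_cmul pG) simp
  fix \<zeta> :: "real ^ 'q"
  have "?G i (b *\<^sub>R - \<zeta>) = - ?G i (b *\<^sub>R \<zeta>)" if "i \<le> d div 2" for i
  proof -
    have "odd (d - 2 * i)" using \<open>odd d\<close> that by simp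
    then show ?thesis using homogD[OF hG[of i], of "-1" "b *\<^sub>R \<zeta>"] by simp
  qed
  then show "(\<Sum>i\<le>d div 2. (a ^ (2 * i) / pizzetti_const CARD('p) i) *\<^sub>R ?G i (b *\<^sub>R - \<zeta>))
      = - (\<Sum>i\<le>d div 2. (a ^ (2 * i) / pizzetti_const CARD('p) i) *\<^sub>R ?G i (b *\<^sub>R \<zeta>))"
    by (simp add: sum_negf[symmetric])
qed

text \<open>
  Pizzetti's formula in both blocks: of each term that the first block leaves, a homogeneous polynomial
  in the second block, only the iterated Laplacian of full degree contributes. By harmonicity all these
  mixed derivatives of \<open>P\<close> agree up to sign, so \<open>P\<close> enters through a single number and the dependence on
  \<open>a\<close> and \<open>b\<close> is universal.
\<close>
lemma bispherical_mean_harmonic: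
  fixes P :: "real ^ ('p::finite + 'q::finite) \<Rightarrow> 'b::euclidean_space"
  assumes P: "polynomial_function P" "homog (2 * m) P" "lap Basis P = (\<lambda>x. 0)"
  shows "(LINT \<zeta>|sphere_measure. LINT \<eta>|sphere_measure. P (vec_join (a *\<^sub>R \<eta>) (b *\<^sub>R \<zeta>)))
    = (\<Sum>i\<le>m. (- 1) ^ i * a ^ (2 * i) * b ^ (2 * (m - i)) /
         (pizzetti_const CARD('p) i * pizzetti_const CARD('q) (m - i))) *\<^sub>R (lap snd_axes ^^ m) P 0"
proof -
  let ?p = "pizzetti_const CARD('p)" and ?q = "pizzetti_const CARD('q)"
  let ?A = "fst_axes :: (real ^ ('p + 'q)) set" and ?B = "snd_axes :: (real ^ ('p + 'q)) set"
  let ?G = "\<lambda>i y. (lap ?A ^^ i) P (vec_join 0 y)"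
  have pG: "polynomial_function (?G i)" for i
    by (intro polynomial_function_vec_join_0 polynomial_function_lap_power P)
  have hG: "homog (2 * (m - i)) (?G i)" for i
    using homog_vec_join_0[OF homog_lap_power[OF P(1,2), of i ?A]] by (simp add: diff_mult_distrib2)
  have outer: "(LINT \<zeta>|sphere_measure. ?G i (b *\<^sub>R \<zeta>)) = (b ^ (2 * (m - i)) * (- 1) ^ i / ?q (m - i)) *\<^sub>R (lap ?B ^^ m) P 0"
    if i: "i \<le> m" for i
  proof -
    have "sphere_mean (?G i) = (lap Basis ^^ (m - i)) (?G i) 0 /\<^sub>R ?q (m - i)"
      using sphere_mean_homog_even[OF pG hG] by simp
    also have "(lap Basis ^^ (m - i)) (?G i) 0 = (lap ?B ^^ (m - i)) ((lap ?A ^^ i) P) 0"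
      using lap_power_affine[OF linear_vec_join(2) inj_on_vec_join(2)[of Basis], of "m - i" "(lap ?A ^^ i) P" 0] by (simp add: snd_axes_def)
    also have "\<dots> = (- 1) ^ i *\<^sub>R (lap ?B ^^ m) P 0"
      by (rule lap_power_mixed[OF P(1,3) axes_partition i])
    finally show ?thesis by (simp add: homogD[OF hG] divide_inverse mult.commute mult.left_commute)
  qed
  have int: "integrable sphere_measure (\<lambda>\<zeta>. (a ^ (2 * i) / ?p i) *\<^sub>R ?G i (b *\<^sub>R \<zeta>))" for i
    unfolding homogD[OF hG]
    by (intro integrable_sphere_polynomial polynomial_function_cmul pG)
  have "(LINT \<zeta>|sphere_measure. LINT \<eta>|sphere_measure. P (vec_join (a *\<^sub>R \<eta>) (b *\<^sub>R \<zeta>)))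
      = (\<Sum>i\<le>m. LINT \<zeta>|sphere_measure. (a ^ (2 * i) / ?p i) *\<^sub>R ?G i (b *\<^sub>R \<zeta>))"
    unfolding first_block_mean[OF P(1,2)] nonzero_mult_div_cancel_left[OF zero_neq_numeral[symmetric]]
    by (rule Bochner_Integration.integral_sum) (rule int)
  also have "\<dots> = (\<Sum>i\<le>m. (a ^ (2 * i) / ?p i) *\<^sub>R ((b ^ (2 * (m - i)) * (- 1) ^ i / ?q (m - i)) *\<^sub>R (lap ?B ^^ m) P 0))"
    by (intro sum.cong refl) (simp add: outer del: scaleR_scaleR)
  also have "\<dots> = (\<Sum>i\<le>m. (- 1) ^ i * a ^ (2 * i) * b ^ (2 * (m - i)) / (?p i * ?q (m - i))) *\<^sub>R (lap ?B ^^ m) P 0"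
    unfolding scaleR_sum_left by (intro sum.cong refl) (simp add: mult_ac)
  finally show ?thesis .
qed

section \<open>Jacobi polynomials\<close>

text \<open>
  The form in which the binomial coefficients of a Jacobi polynomial appear when its parameter is
  \<open>c - 1\<close>, half the dimension of a coordinate block minus one.
\<close>
lemma gbinomial_shifted:
  fixes c :: real
  assumes c: "c > 0" and s: "s \<le> m"
  shows "(real m + (c - 1)) gchoose (m - s) = pochhammer c m / (pochhammer c s * fact (m - s))"
proof -
  have "pochhammer c m = pochhammer c s * pochhammer (c + real s) (m - s)"
    using pochhammer_product[OF s, of c] by simp
  moreover have "pochhammer c s > 0" using c by (rule pochhammer_pos)
  moreover have "real m + (c - 1) - real (m - s) + 1 = c + real s" using s by (simp add: of_nat_diff)
  ultimately show ?thesis by (simp add: gbinomial_pochhammer')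
qed

text \<open>
  Regrouped so that the denominators are the products of two Pizzetti constants.
\<close>
lemma jacobi_P_shifted:
  assumes "c > 0" "d > 0"
  shows "jacobi_P (c - 1) (d - 1) m t = 4 ^ m * pochhammer c m * pochhammer d m *
    (\<Sum>i\<le>m. ((t - 1) / 2) ^ i * ((t + 1) / 2) ^ (m - i) /
       ((4 ^ i * fact i * pochhammer c i) * (4 ^ (m - i) * fact (m - i) * pochhammer d (m - i))))"
  unfolding jacobi_P_def sum_distrib_left
proof (intro sum.cong refl)
  fix i assume "i \<in> {..m}"
  then have i: "i \<le> m" by simp
  have "(real m + (d - 1)) gchoose i = pochhammer d m / (pochhammer d (m - i) * fact i)"
    using gbinomial_shifted[OF assms(2), of "m - i" m] i by simp
  moreover have "(4::real) ^ m = 4 ^ i * 4 ^ (m - i)" using i by (simp add: power_add[symmetric])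
  ultimately show "(real m + (c - 1) gchoose (m - i)) * (real m + (d - 1) gchoose i) * ((t - 1) / 2) ^ i * ((t + 1) / 2) ^ (m - i) =
      4 ^ m * pochhammer c m * pochhammer d m * (((t - 1) / 2) ^ i * ((t + 1) / 2) ^ (m - i) /
       ((4 ^ i * fact i * pochhammer c i) * (4 ^ (m - i) * fact (m - i) * pochhammer d (m - i))))"
    using gbinomial_shifted[OF assms(1) i] by (simp add: mult_ac)
qed

text \<open>
  At \<open>t = 1\<close> only the summand without a factor \<open>t - 1\<close> is left.
\<close>
lemma jacobi_P_at_1:
  assumes "c > 0"
  shows "jacobi_P (c - 1) b m 1 = pochhammer c m / fact m"
proof -
  have "jacobi_P (c - 1) b m 1 = (\<Sum>s\<in>{0}. ((real m + (c - 1)) gchoose (m - s)) * ((real m + b) gchoose s) *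
      0 ^ s * 1 ^ (m - s))"
    unfolding jacobi_P_def by (rule sum.mono_neutral_cong_right) auto
  then show ?thesis using gbinomial_shifted[OF assms, of 0 m] by simp
qed

text \<open>
  With \<open>t = 2 * \<tau>\<^sup>2 - 1\<close> the squared radii of the two spheres are \<open>(1 - t) / 2\<close> and \<open>(1 + t) / 2\<close>, and the signs
  that harmonicity produces are exactly those of the powers of \<open>(t - 1) / 2\<close> in the Jacobi polynomial.
\<close>
lemma bispherical_mean_jacobi:
  fixes P :: "real ^ ('p::finite + 'q::finite) \<Rightarrow> 'b::euclidean_space"
  assumes P: "polynomial_function P" "homog (2 * m) P" "lap Basis P = (\<lambda>x. 0)" and \<tau>: "\<tau> \<in> {0..1}"
  defines "c \<equiv> real CARD('p) / 2" and "d \<equiv> real CARD('q) / 2"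
  shows "(LINT \<zeta>|sphere_measure. LINT \<eta>|sphere_measure. P (vec_join (sqrt (1 - \<tau>\<^sup>2) *\<^sub>R \<eta>) (\<tau> *\<^sub>R \<zeta>)))
    = (jacobi_P (c - 1) (d - 1) m (2 * \<tau>\<^sup>2 - 1) / (4 ^ m * pochhammer c m * pochhammer d m)) *\<^sub>R (lap snd_axes ^^ m) P 0"
proof -
  have cd: "c > 0" "d > 0" by (simp_all add: c_def d_def)
  have "\<tau>\<^sup>2 \<le> 1" using \<tau> by (simp add: power_le_one)
  then have "(- 1) ^ i * sqrt (1 - \<tau>\<^sup>2) ^ (2 * i) = (\<tau>\<^sup>2 - 1) ^ i" for i
    by (simp add: power_mult power_mult_distrib[symmetric])
  moreover have half: "(2 * \<tau>\<^sup>2 - 2) / 2 = \<tau>\<^sup>2 - 1" by (simp add: field_simps)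
  moreover have "pochhammer c m > 0" "pochhammer d m > 0" using cd by (simp_all add: pochhammer_pos)
  ultimately show ?thesis
    by (simp add: bispherical_mean_harmonic[OF P] jacobi_P_shifted[OF cd] pizzetti_const_def power_mult half
        c_def[symmetric] d_def[symmetric])
qed

text \<open>
  On the sphere the Jacobi polynomial is a combination of products of powers of the squared block
  norms. The alternating signs from \<open>(t - 1) / 2\<close> cancel those from harmonicity, so the products of
  binomial coefficients are summed without signs and Vandermonde's identity evaluates the sum. This
  takes the place of the integral of the squared Jacobi polynomial over the interval.
\<close>
lemma jacobi_harmonic_mean:
  fixes P :: "real ^ ('p::finite + 'q::finite) \<Rightarrow> 'b::euclidean_space"
  assumes P: "polynomial_function P" "homog (2 * m) P" "lap Basis P = (\<lambda>x. 0)"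
  shows "sphere_mean (\<lambda>x. jacobi_P a b m (2 * norm_sq_on snd_axes x - 1) *\<^sub>R P x)
    = (((2 * real m + a + b) gchoose m) / fischer_const CARD('p + 'q) m) *\<^sub>R (lap snd_axes ^^ m) P 0"
proof -
  let ?A = "fst_axes :: (real ^ ('p + 'q)) set" and ?B = "snd_axes :: (real ^ ('p + 'q)) set"
  let ?w = "\<lambda>s. ((real m + a) gchoose (m - s)) * ((real m + b) gchoose s)"
  let ?T = "(lap ?B ^^ m) P 0"
  have dim: "DIM(real ^ ('p + 'q)) \<ge> 2"
  proof -
    have "2 \<le> CARD('p) + CARD('q)"
      using zero_less_card_finite[where 'a='p] zero_less_card_finite[where 'a='q] by linarith
    then show ?thesis by simp
  qed
  have sub: "?A \<subseteq> Basis" "?B \<subseteq> Basis" using axes_partition(1)[where 'p='p and 'q='q] by blast+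
  have fin: "finite ?A" "finite ?B" using sub by (auto intro: finite_subset[OF _ finite_Basis])
  have one: "norm_sq_on ?A x = 1 - norm_sq_on ?B x" if x: "x \<in> sphere 0 1" for x
  proof -
    obtain u v where uv: "x = vec_join u v" by (rule vec_join_cases)
    then have "(norm u)\<^sup>2 + (norm v)\<^sup>2 = 1" using x norm_vec_join[of u v] by simp
    then show ?thesis by (simp add: uv norm_sq_on_axes)
  qed
  have mono: "sphere_mean (\<lambda>x. (norm_sq_on ?A x ^ s * norm_sq_on ?B x ^ (m - s)) *\<^sub>R P x)
      = ((- 1) ^ s / fischer_const CARD('p + 'q) m) *\<^sub>R ?T" if s: "s \<le> m" for s
  proof -
    have "sphere_mean (\<lambda>x. (norm_sq_on ?A x ^ s * norm_sq_on ?B x ^ (m - s)) *\<^sub>R P x)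
        = (lap ?B ^^ (m - s)) ((lap ?A ^^ s) P) 0 /\<^sub>R fischer_const CARD('p + 'q) m"
      using harmonic_bihomogeneous_mean[OF dim sub, of P s "m - s"] P s by simp
    also have "(lap ?B ^^ (m - s)) ((lap ?A ^^ s) P) 0 = (- 1) ^ s *\<^sub>R ?T"
      by (rule lap_power_mixed[OF P(1,3) axes_partition s])
    finally show ?thesis by (simp add: divide_inverse mult.commute)
  qed
  have int: "integrable sphere_measure (\<lambda>x. (norm_sq_on ?A x ^ s * norm_sq_on ?B x ^ (m - s)) *\<^sub>R P x)" for s
    by (intro integrable_sphere_polynomial polynomial_function_mult[where g = P] polynomial_function_norm_sq_monomial fin P)
  have "sphere_mean (\<lambda>x. jacobi_P a b m (2 * norm_sq_on ?B x - 1) *\<^sub>R P x)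
      = sphere_mean (\<lambda>x. \<Sum>s\<le>m. (?w s * (- 1) ^ s) *\<^sub>R ((norm_sq_on ?A x ^ s * norm_sq_on ?B x ^ (m - s)) *\<^sub>R P x))"
  proof (rule Bochner_Integration.integral_cong[OF refl])
    fix x assume "x \<in> space (sphere_measure :: (real ^ ('p + 'q)) measure)"
    then have "norm_sq_on ?A x = 1 - norm_sq_on ?B x" by (intro one) simp
    then have *: "(2 * norm_sq_on ?B x - 1 - 1) / 2 = - norm_sq_on ?A x" by simp
    have **: "(2 * norm_sq_on ?B x - 1 + 1) / 2 = norm_sq_on ?B x" by simp
    show "jacobi_P a b m (2 * norm_sq_on ?B x - 1) *\<^sub>R P x
        = (\<Sum>s\<le>m. (?w s * (- 1) ^ s) *\<^sub>R ((norm_sq_on ?A x ^ s * norm_sq_on ?B x ^ (m - s)) *\<^sub>R P x))"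
      unfolding jacobi_P_def * ** scaleR_sum_left
      by (intro sum.cong refl) (simp add: power_minus[of "norm_sq_on _ _"] mult.assoc)
  qed
  also have "\<dots> = (\<Sum>s\<le>m. (?w s * (- 1) ^ s) *\<^sub>R (((- 1) ^ s / fischer_const CARD('p + 'q) m) *\<^sub>R ?T))"
    using int by (subst Bochner_Integration.integral_sum) (auto simp: mono simp del: scaleR_scaleR intro!: sum.cong)
  also have "\<dots> = ((\<Sum>s\<le>m. ?w s) / fischer_const CARD('p + 'q) m) *\<^sub>R ?T"
    unfolding sum_divide_distrib scaleR_sum_left
  proof (intro sum.cong refl)
    fix s
    have "(- 1) ^ s * (- 1) ^ s = (1::real)" by (simp add: power_mult_distrib[symmetric])
    then have "?w s * (- 1) ^ s * ((- 1) ^ s / fischer_const CARD('p + 'q) m) = ?w s / fischer_const CARD('p + 'q) m"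
      by (simp add: mult.assoc)
    then show "(?w s * (- 1) ^ s) *\<^sub>R (((- 1) ^ s / fischer_const CARD('p + 'q) m) *\<^sub>R ?T)
        = (?w s / fischer_const CARD('p + 'q) m) *\<^sub>R ?T"
      by simp
  qed
  also have "(\<Sum>s\<le>m. ?w s) = (2 * real m + a + b) gchoose m"
    using gbinomial_Vandermonde[of "real m + b" "real m + a" m]
    by (simp add: atLeast0AtMost mult.commute algebra_simps)
  finally show ?thesis .
qed

section \<open>The normalizing constant\<close>

text \<open>
  All powers of \<open>\<pi>\<close> cancel because the dimensions of the blocks add up to the dimension of the space, and the
  quotients of Gamma values become Pochhammer symbols. Here \<open>h = c + d - 1\<close> is positive because \<open>n \<ge> 2\<close>.
\<close>
lemma varkappa_squared:
  fixes n k m :: nat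
  assumes n: "n \<ge> 2" and k: "k \<le> n - 1"
  defines "c \<equiv> (real k + 1) / 2" and "d \<equiv> (real n - real k) / 2" and "h \<equiv> (real n - 1) / 2"
  shows "(varkappa n k (2 * m))\<^sup>2 =
    (2 * real m + h) * pochhammer c m * pochhammer h m / (h * fact m * pochhammer d m)"
proof -
  have pos: "c > 0" "d > 0" "h > 0" using n k by (auto simp: c_def d_def h_def)
  have nk: "real (n - k - 1) + 1 = 2 * d" "real k + 1 = 2 * c" "real n + 1 = 2 * (c + d)" "real n - 1 = 2 * h"
    "c + d = h + 1" "real n - real k = 2 * d"
    using n k by (auto simp: c_def d_def h_def of_nat_diff field_simps)
  have G: "Gamma (x + real m) = pochhammer x m * Gamma x" if "x > 0" for x :: real
  proof -
    have "x \<notin> \<int>\<^sub>\<le>\<^sub>0" using that by (auto elim!: nonpos_Ints_cases)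
    moreover have "Gamma x \<noteq> 0" using Gamma_real_pos[OF that] by simp
    ultimately show ?thesis by (simp add: pochhammer_Gamma)
  qed
  have Gpos: "Gamma c > 0" "Gamma d > 0" "Gamma h > 0" using pos by (simp_all add: Gamma_real_pos)
  have Gh: "Gamma (h + 1) = h * Gamma h" using pos Gamma_plus1[of h] by (auto simp: nonpos_Ints_def)
  have ph: "pochhammer c m > 0" "pochhammer d m > 0" "pochhammer h m > 0" using pos by (simp_all add: pochhammer_pos)
  have args: "(real (2 * m) + real k + 1) / 2 = c + real m" "(real (2 * m) + real n - 1) / 2 = h + real m"
    "(real (2 * m) + real n - real k) / 2 = d + real m" "2 * real (2 * m) + real n - 1 = 2 * (2 * real m + h)"
    "real (2 * m) / 2 + 1 = 1 + real m"
    using nk by (simp_all add: field_simps)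
  have area: "sphere_area n = 2 * pi powr (c + d) / Gamma (h + 1)" "sphere_area k = 2 * pi powr c / Gamma c"
    "sphere_area (n - k - 1) = 2 * pi powr d / Gamma d"
    unfolding sphere_area_def nk by (simp_all del: distrib_left_numeral)
  have cancel: "2 * (a * b) / (h * y) * (2 * w) * (p * u) * (q * y) / (2 * b / v * (2 * a / u) * u\<^sup>2 * f * (r * v))
      = w * p * q / (h * f * r)"
    if "h > 0" "u > 0" "v > 0" "y > 0" "r > 0" "a > 0" "b > 0" "f > 0"
    for a b f h p q r u v w y :: real
    using that by (simp add: field_simps power2_eq_square)
  have "Gamma (1 + real m) = fact m" using Gamma_fact[of m, where 'a = real] by simp
  then have eq: "sphere_area n * (2 * real (2 * m) + real n - 1) *
        Gamma ((real (2 * m) + real k + 1) / 2) * Gamma ((real (2 * m) + real n - 1) / 2) /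
      (sphere_area (n - k - 1) * sphere_area k * (Gamma ((real k + 1) / 2))\<^sup>2 *
        Gamma (real (2 * m) / 2 + 1) * Gamma ((real (2 * m) + real n - real k) / 2))
     = (2 * real m + h) * pochhammer c m * pochhammer h m / (h * fact m * pochhammer d m)"
    unfolding args area c_def[symmetric] G[OF pos(1)] G[OF pos(2)] G[OF pos(3)] Gh powr_add
    using cancel[OF pos(3) Gpos ph(2), of "pi powr c" "pi powr d" "fact m" "2 * real m + h" "pochhammer c m" "pochhammer h m"]
    by simp
  have "0 \<le> (2 * real m + h) * pochhammer c m * pochhammer h m / (h * fact m * pochhammer d m)"
    using ph pos by simp
  then show ?thesis
    unfolding varkappa_def eq by (rule real_sqrt_pow2)
qed

text \<open>
  This is the identity that the normalizing constant is made for: it reconciles the coefficient of the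
  bispherical mean with that of the integral against the Jacobi polynomial. The Pochhammer symbols of
  length \<open>m\<close> at \<open>h\<close> and at \<open>h + m\<close> combine to one of length \<open>2 * m\<close>, which is the one in the Fischer constant
  up to a shift by one.
\<close>
lemma varkappa_normalization:
  fixes n k m :: nat
  assumes n: "n \<ge> 2" and k: "k \<le> n - 1"
  defines "c \<equiv> (real k + 1) / 2" and "d \<equiv> (real n - real k) / 2"
  shows "(varkappa n k (2 * m))\<^sup>2 * ((2 * real m + (c - 1) + (d - 1)) gchoose m) / fischer_const (n + 1) m
      / (jacobi_P (c - 1) (d - 1) m 1)\<^sup>2 = 1 / (4 ^ m * pochhammer c m * pochhammer d m)"
proof -
  define h where "h = (real n - 1) / 2"
  have pos: "c > 0" "d > 0" "h > 0" using n k by (auto simp: c_def d_def h_def)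
  have cdh: "c + d = h + 1" by (simp add: c_def d_def h_def field_simps)
  then have eq: "2 * real m + (c - 1) + (d - 1) - real m + 1 = h + real m" by simp
  have C: "(2 * real m + (c - 1) + (d - 1)) gchoose m = pochhammer (h + real m) m / fact m"
    unfolding gbinomial_pochhammer' eq ..
  have h1: "real (n + 1) / 2 = h + 1" by (simp add: h_def field_simps)
  have poch: "h * pochhammer (h + 1) (2 * m) = pochhammer h m * pochhammer (h + real m) m * (2 * real m + h)"
  proof -
    have "h * pochhammer (h + 1) (2 * m) = pochhammer h (Suc (2 * m))" by (simp add: pochhammer_rec)
    also have "\<dots> = pochhammer h (2 * m) * (2 * real m + h)" by (simp add: pochhammer_Suc add.commute)
    also have "pochhammer h (2 * m) = pochhammer h m * pochhammer (h + real m) m"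
      using pochhammer_product[of m "2 * m" h] by (simp add: mult_2)
    finally show ?thesis .
  qed
  have ph: "pochhammer c m > 0" "pochhammer d m > 0" "pochhammer (h + 1) (2 * m) > 0"
    using pos by (simp_all add: pochhammer_pos)
  have "(varkappa n k (2 * m))\<^sup>2 * (pochhammer (h + real m) m / fact m) / fischer_const (n + 1) m
      / (pochhammer c m / fact m)\<^sup>2
     = (pochhammer h m * pochhammer (h + real m) m * (2 * real m + h)) /
       (h * pochhammer (h + 1) (2 * m)) / (4 ^ m * pochhammer c m * pochhammer d m)"
    unfolding varkappa_squared[OF n k] fischer_const_def h1 c_def[symmetric] d_def[symmetric] h_def[symmetric]
    using ph pos by (simp add: field_simps power2_eq_square)
  also have "\<dots> = 1 / (4 ^ m * pochhammer c m * pochhammer d m)"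
    unfolding poch[symmetric] using ph pos by simp
  finally show ?thesis unfolding C jacobi_P_at_1[OF pos(1)] .
qed

section \<open>Moving a frame to the standard frame\<close>

text \<open>
  The Laplacian may be computed in any orthonormal basis: it is the trace of the second derivative.
\<close>
lemma lap_orthonormal_frame:
  fixes f :: "'a::euclidean_space \<Rightarrow> 'b::euclidean_space" and T :: "'a \<Rightarrow> 'a"
  assumes T: "orthogonal_transformation T" and f: "polynomial_function f"
  shows "lap (T ` Basis) f = lap Basis f"
proof
  fix x
  have TT: "T u \<bullet> T v = u \<bullet> v" for u v using T by (simp add: orthogonal_transformation_def)
  have inj: "inj_on T Basis" using orthogonal_transformation_inj[OF T] by (rule inj_on_subset) simp
  have frame: "(\<Sum>b\<in>Basis. (T b \<bullet> c) * (T b \<bullet> d)) = c \<bullet> d" for c d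
  proof -
    obtain c' d' where "c = T c'" "d = T d'" using orthogonal_transformation_surj[OF T] by (meson surjD)
    then show ?thesis by (simp add: TT euclidean_inner[of c' d'] inner_commute)
  qed
  have dir: "D u g y = (\<Sum>c\<in>Basis. (u \<bullet> c) *\<^sub>R D c g y)" if "polynomial_function g" for u y and g :: "'a \<Rightarrow> 'b"
    using D_sum_direction[OF that, of "\<lambda>c. u \<bullet> c" "\<lambda>c. c" Basis y] by (simp add: euclidean_representation)
  have "D u (D u f) x = (\<Sum>c\<in>Basis. \<Sum>d\<in>Basis. ((u \<bullet> c) * (u \<bullet> d)) *\<^sub>R D c (D d f) x)" for u
  proof -
    have "D u f = (\<lambda>y. \<Sum>d\<in>Basis. (u \<bullet> d) *\<^sub>R D d f y)" using dir[OF f] by blast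
    then have "D c (D u f) x = (\<Sum>d\<in>Basis. (u \<bullet> d) *\<^sub>R D c (D d f) x)" for c
      using f by (simp add: D_sum D_scale polynomial_function_D polynomial_function_cmul)
    then show ?thesis
      by (subst dir[OF polynomial_function_D[OF f]]) (simp add: scaleR_sum_right)
  qed
  then have "lap (T ` Basis) f x
      = (\<Sum>b\<in>Basis. \<Sum>c\<in>Basis. \<Sum>d\<in>Basis. ((T b \<bullet> c) * (T b \<bullet> d)) *\<^sub>R D c (D d f) x)"
    by (simp add: lap_def sum.reindex[OF inj])
  also have "\<dots> = (\<Sum>c\<in>Basis. \<Sum>d\<in>Basis. \<Sum>b\<in>Basis. ((T b \<bullet> c) * (T b \<bullet> d)) *\<^sub>R D c (D d f) x)"
    by (subst sum.swap) (intro sum.cong refl sum.swap)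
  also have "\<dots> = (\<Sum>c\<in>Basis. \<Sum>d\<in>Basis. (c \<bullet> d) *\<^sub>R D c (D d f) x)"
    by (simp add: frame flip: scaleR_sum_left)
  also have "\<dots> = (\<Sum>c\<in>Basis. \<Sum>d\<in>Basis. if c = d then D c (D d f) x else 0)"
    by (intro sum.cong refl) (auto simp: inner_Basis)
  also have "\<dots> = lap Basis f x" by (simp add: lap_def sum.delta')
  finally show "lap (T ` Basis) f x = lap Basis f x" .
qed

lemma harmonic_orthogonal:
  fixes f :: "'a::euclidean_space \<Rightarrow> 'b::euclidean_space" and T :: "'a \<Rightarrow> 'a"
  assumes T: "orthogonal_transformation T" and f: "polynomial_function f" "lap Basis f = (\<lambda>x. 0)"
  shows "lap Basis (\<lambda>x. f (T x)) = (\<lambda>x. 0)"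
  using lap_affine[of T Basis f 0] orthogonal_transformation_linear[OF T]
    inj_on_subset[OF orthogonal_transformation_inj[OF T]] lap_orthonormal_frame[OF T f(1)] f(2)
  by simp

lemma norm_sq_snd_axes_base:
  fixes x :: "real ^ ('p::finite + 'q::finite)"
  shows "(norm (x v* (stiefel_base :: real ^ 'q ^ ('p + 'q))))\<^sup>2 = norm_sq_on snd_axes x"
proof -
  obtain u w where x: "x = vec_join u w" by (rule vec_join_cases)
  have "(x v* (stiefel_base :: real ^ 'q ^ ('p + 'q))) \<bullet> y = w \<bullet> y" for y
    by (simp add: dot_lmul_matrix stiefel_base_mult x inner_vec_join)
  then have "x v* (stiefel_base :: real ^ 'q ^ ('p + 'q)) = w" by (metis vector_eq_rdot)
  then show ?thesis by (simp add: x norm_sq_on_axes)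
qed

text \<open>
  Rotating by \<open>r\<close> moves the frame \<open>v\<close> to the standard frame, for which the length of \<open>x v* v\<close> is the norm of the
  second coordinate block.
\<close>
lemma stiefel_integral:
  fixes v :: "real ^ 'q ^ ('p::finite + 'q::finite)" and P :: "real ^ ('p + 'q) \<Rightarrow> complex"
  assumes r: "orthogonal_matrix r" "r ** stiefel_base = v"
    and P: "continuous_on UNIV P" and J: "continuous_on UNIV J"
  shows "(LINT x|sphere_measure. P x * of_real (J (2 * (norm (x v* v))\<^sup>2 - 1)))
    = sphere_mean (\<lambda>x. J (2 * norm_sq_on snd_axes x - 1) *\<^sub>R P (r *v x))"
proof -
  have T: "orthogonal_transformation ((*v) r)" using r by (simp add: orthogonal_transformation_matrix)
  let ?f = "\<lambda>x. P x * of_real (J (2 * (norm (x v* v))\<^sup>2 - 1))"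
  have "continuous_on UNIV (\<lambda>x. x v* v)"
    unfolding transpose_matrix_vector[symmetric]
    by (rule linear_continuous_on[OF matrix_vector_mul_bounded_linear])
  then have "continuous_on UNIV ?f"
    by (intro continuous_intros P continuous_on_compose2[OF J]) auto
  then have "sphere_mean ?f = sphere_mean (\<lambda>x. ?f (r *v x))"
    by (intro sphere_mean_orthogonal[symmetric] T borel_measurable_sphere_continuous)
  moreover have "(r *v x) v* v = x v* (stiefel_base :: real ^ 'q ^ ('p + 'q))" for x
  proof -
    have "(r *v x) v* v = (transpose (r ** (stiefel_base :: real ^ 'q ^ ('p + 'q))) ** r) *v x"
      by (simp only: r(2)[symmetric] transpose_matrix_vector[symmetric] matrix_vector_mul_assoc)
    also have "transpose (r ** (stiefel_base :: real ^ 'q ^ ('p + 'q))) ** r = transpose stiefel_base"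
      using r(1) by (simp only: matrix_transpose_mul matrix_mul_assoc[symmetric] orthogonal_matrix_def matrix_mul_rid)
    finally show ?thesis by (simp only: transpose_matrix_vector)
  qed
  ultimately show ?thesis
    by (simp add: norm_sq_snd_axes_base scaleR_conv_of_real mult.commute)
qed

lemma continuous_on_jacobi_nk: "continuous_on A (jacobi_nk n k m)"
  unfolding jacobi_nk_def[abs_def] jacobi_R_def jacobi_P_def divide_inverse
  by (intro continuous_intros)

theorem theorem3p4:
  fixes n k j :: nat and \<tau> :: real
    and v :: "real ^ 'q ^ ('p::finite + 'q::finite)"
    and Y :: "real ^ ('p::finite + 'q::finite) \<Rightarrow> complex"
  assumes "n \<ge> 2" and "1 \<le> k" and "k \<le> n - 1"
    and "CARD('p) = k + 1" and "CARD('q) = n - k"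
    and "v \<in> stiefel"
    and "spherical_harmonic j Y"
    and "\<tau> \<in> {0..1}"
  shows "bispherical_mean \<tau> Y v =
    (if odd j then 0 else of_real (multiplier n k \<tau> j) * stiefel_harmonic n k j Y v)"
proof -
  obtain P where P: "polynomial_function P" "homog j P" "lap Basis P = (\<lambda>x. 0)"
    and YP: "\<And>x. x \<in> sphere 0 1 \<Longrightarrow> Y x = P x"
    using \<open>spherical_harmonic j Y\<close>
    by (auto simp: spherical_harmonic_def homog_def laplacian_def lap_def[abs_def])
  obtain r where r: "orthogonal_matrix r" "r ** stiefel_base = v"
    using stiefel_rotation_exists[OF \<open>v \<in> stiefel\<close>] by blast
  have T: "orthogonal_transformation ((*v) r)" using r by (simp add: orthogonal_transformation_matrix)
  define Q where "Q = (\<lambda>x. P (r *v x))"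
  have Q: "polynomial_function Q" "homog j Q" "lap Basis Q = (\<lambda>x. 0)"
    using polynomial_function_affine[OF P(1) orthogonal_transformation_linear[OF T], of 0]
      homogD[OF P(2)] harmonic_orthogonal[OF T P(1,3)]
    by (simp_all add: Q_def homog_def matrix_vector_mult_scaleR)
  have cP: "continuous_on UNIV P" by (rule continuous_on_polymonial_function[OF P(1)])
  have "P \<in> borel_measurable sphere_measure" by (rule borel_measurable_sphere_continuous[OF cP])
  then have mY: "Y \<in> borel_measurable sphere_measure" using YP by (subst measurable_cong) auto
  have "\<tau>\<^sup>2 \<le> 1" using \<open>\<tau> \<in> {0..1}\<close> by (simp add: power_le_one)
  then have unit: "r *v vec_join (sqrt (1 - \<tau>\<^sup>2) *\<^sub>R \<eta>) (\<tau> *\<^sub>R \<zeta>) \<in> sphere 0 1"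
    if "norm \<eta> = 1" "norm \<zeta> = 1" for \<eta> :: "real ^ 'p" and \<zeta> :: "real ^ 'q"
    using that norm_vec_join[of "sqrt (1 - \<tau>\<^sup>2) *\<^sub>R \<eta>" "\<tau> *\<^sub>R \<zeta>"]
    by (simp add: orthogonal_transformation_norm[OF T] power_mult_distrib abs_square_eq_1)
  have "bispherical_mean \<tau> Y v = bispherical_integral r \<tau> Y"
    by (rule bispherical_mean_eq[OF r mY \<open>\<tau> \<in> {0..1}\<close>])
  also have "\<dots> = (LINT \<zeta>|sphere_measure. LINT \<eta>|sphere_measure. Q (vec_join (sqrt (1 - \<tau>\<^sup>2) *\<^sub>R \<eta>) (\<tau> *\<^sub>R \<zeta>)))"
    unfolding bispherical_integral_def Q_def
    by (intro Bochner_Integration.integral_cong refl) (use unit YP in auto)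
  finally have mean: "bispherical_mean \<tau> Y v = \<dots>" .
  show ?thesis
  proof (cases "odd j")
    case True
    then show ?thesis using bispherical_mean_odd[OF Q(1,2)] mean by simp
  next
    case False
    then obtain m where j: "j = 2 * m" by blast
    define c d where "c = (real k + 1) / 2" and "d = (real n - real k) / 2"
    have card: "real CARD('p) / 2 = c" "real CARD('q) / 2 = d" "CARD('p + 'q) = n + 1"
      using assms(1,3,4,5) by (simp_all add: c_def d_def of_nat_diff)
    have rho: "(real k - 1) / 2 = c - 1" "(real n - real k) / 2 - 1 = d - 1"
      by (simp_all add: c_def d_def field_simps)
    let ?T = "(lap snd_axes ^^ m) Q 0" and ?J = "jacobi_P (c - 1) (d - 1) m"
    let ?C = "(2 * real m + (c - 1) + (d - 1)) gchoose m"
    have jd: "j div 2 = m" using j by simp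
    have Q2: "homog (2 * m) Q" using Q(2) j by simp
    have "harmonic_dim n j > 0"
      using assms(1) by (simp add: harmonic_dim_def Gamma_real_pos)
    then have dim: "sqrt (harmonic_dim n j) \<noteq> 0" by simp
    have jac: "jacobi_nk n k m t = ?J t / ?J 1" for t
      by (simp add: jacobi_nk_def jacobi_R_def rho)
    have "(LINT x|sphere_measure. Y x * of_real (jacobi_nk n k m (2 * (norm (x v* v))\<^sup>2 - 1)))
        = (LINT x|sphere_measure. P x * of_real (jacobi_nk n k m (2 * (norm (x v* v))\<^sup>2 - 1)))"
      by (intro Bochner_Integration.integral_cong refl) (use YP in auto)
    also have "\<dots> = sphere_mean (\<lambda>x. (1 / ?J 1) *\<^sub>R (?J (2 * norm_sq_on snd_axes x - 1) *\<^sub>R Q x))"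
      unfolding stiefel_integral[OF r cP continuous_on_jacobi_nk] by (simp add: jac Q_def)
    also have "\<dots> = (1 / ?J 1) *\<^sub>R sphere_mean (\<lambda>x. ?J (2 * norm_sq_on snd_axes x - 1) *\<^sub>R Q x)"
      by (rule integral_scaleR_right)
    also have "\<dots> = (1 / ?J 1) *\<^sub>R ((?C / fischer_const (n + 1) m) *\<^sub>R ?T)"
      using jacobi_harmonic_mean[OF Q(1) Q2 Q(3), of "c - 1" "d - 1"] card(3) by simp
    finally have int: "(LINT x|sphere_measure. Y x * of_real (jacobi_nk n k m (2 * (norm (x v* v))\<^sup>2 - 1)))
        = (?C / fischer_const (n + 1) m / ?J 1) *\<^sub>R ?T" by simp
    have "of_real (multiplier n k \<tau> j) * stiefel_harmonic n k j Y v
        = (?J (2 * \<tau>\<^sup>2 - 1) * ((varkappa n k (2 * m))\<^sup>2 * ?C / fischer_const (n + 1) m / (?J 1)\<^sup>2)) *\<^sub>R ?T"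
      unfolding multiplier_def stiefel_harmonic_def jd int unfolding jac using dim
      by (simp add: j scaleR_conv_of_real mult_ac power2_eq_square[of "varkappa _ _ _"] power2_eq_square[of "jacobi_P _ _ _ 1"])
    also have "\<dots> = (?J (2 * \<tau>\<^sup>2 - 1) / (4 ^ m * pochhammer c m * pochhammer d m)) *\<^sub>R ?T"
      using varkappa_normalization[OF assms(1,3), of m] by (simp add: c_def d_def)
    also have "\<dots> = bispherical_mean \<tau> Y v"
      using bispherical_mean_jacobi[OF Q(1) Q2 Q(3) \<open>\<tau> \<in> {0..1}\<close>] mean card by simp
    finally show ?thesis using False by simp
  qed
qed

end
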